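(* Let $R$ be a left noetherian domain and let $A=\sigma(R)\langle x_1,\dots,x_n\rangle$ be a skew $PBW$ extension of $R$. Then $$\mathrm{GGKdim}(A)=\limsup_{k\to\infty}\log_k\Big(\sum_{i=0}^k\dim_RA_i\Big)=1+\deg(Gp_A(t))=n.$$
   Context: Let $R$ and $A$ be rings (unital, not necessarily commutative). $A$ is a skew $PBW$ extension of $R$, written $A=\sigma(R)\langle x_1,\dots,x_n\rangle$, if: (1) $R\subseteq A$ (subring); (2) there are finitely many elements $x_1,\dots,x_n\in A$ such that $A$ is a free left $R$-module with basis $\mathrm{Mon}(A)=\{x^\alpha=x_1^{\alpha_1}\cdots x_n^{\alpha_n}\mid \alpha\in\mathbb{N}^n\}$, $\mathbb{N}=\{0,1,2,\dots\}$; (3) for every $1\le i\le n$ and $r\in R-\{0\}$ there is $c_{i,r}\in R-\{0\}$ with $x_ir-c_{i,r}x_i\in R$; (4) for every $1\le i,j\le n$ there is $c_{i,j}\in R-\{0\}$ with $x_jx_i-c_{i,j}x_ix_j\in R+Rx_1+\cdots+Rx_n$. The semi-graduation of $A$ is $A=\bigoplus_{k\ge0}A_k$, where $A_k$ is the (free, finite dimensional) left $R$-submodule generated by the monomials $x^\alpha$ with $\alpha_1+\cdots+\alpha_n=k$; in particular $A_0=R$. $\dim_R$ denotes the dimension (rank) of a free left $R$-module. The generalized Hilbert polynomial $Gp_A(t)\in\mathbb{Q}[t]$ of $A$ is the polynomial satisfying $\dim_RA_k=Gp_A(k)$ for all sufficiently large $k$. $\mathrm{udim}$ denotes the uniform (Goldie)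 dimension of a left $R$-module. A frame of $A$ is a finite dimensional free left $R$-submodule $V$ of $A$ such that $1\in V$; $V^k:={}_R\langle v_1\cdots v_k\mid v_i\in V\rangle$ is the left $R$-submodule of $A$ generated by all products of $k$ elements of $V$. The generalized Gelfand-Kirillov dimension of $A$ is $$\mathrm{GGKdim}(A):=\sup_V\limsup_{k\to\infty}\log_k\mathrm{udim}\,V^k,$$ where $V$ ranges over all frames of $A$. *)

theory Defs
  imports
    Complex_Main
    "HOL-Library.Extended_Nat"
    "HOL-Library.Extended_Real"
    "HOL-Library.Liminf_Limsup"
    "HOL-Computational_Algebra.Polynomial"
begin

text \<open>
  The ring \<open>A\<close> is the type \<open>'a :: ring_1\<close>, and \<open>R\<close> is a subset of it that is assumed to be a
  subring where needed. All modules are left \<open>R\<close>-submodules of \<open>A\<close>, the scalar action being the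
  multiplication of \<open>A\<close>. Neither ring is commutative in general, so the module and vector space
  locales of the library do not apply.
\<close>

definition subring_of :: "'a::ring_1 set \<Rightarrow> bool" where
  "subring_of R \<longleftrightarrow> 1 \<in> R \<and> (\<forall>a\<in>R. \<forall>b\<in>R. a - b \<in> R \<and> a * b \<in> R)"

text \<open>\<open>1 \<noteq> 0\<close> is part of the class \<open>ring_1\<close>, so a domain is automatically nonzero.\<close>

definition is_domain :: "'a::ring_1 set \<Rightarrow> bool" where
  "is_domain R \<longleftrightarrow> (\<forall>a\<in>R. \<forall>b\<in>R. a * b = 0 \<longrightarrow> a = 0 \<or> b = 0)"


subsection \<open>Left submodules\<close>

definition left_submodule :: "'a::ring_1 set \<Rightarrow> 'a set \<Rightarrow> bool" where
  "left_submodule R M \<longleftrightarrow>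
     0 \<in> M \<and> (\<forall>u\<in>M. \<forall>v\<in>M. u + v \<in> M) \<and> (\<forall>r\<in>R. \<forall>v\<in>M. r * v \<in> M)"

definition lspan :: "'a::ring_1 set \<Rightarrow> 'a set \<Rightarrow> 'a set" where
  "lspan R S = left_submodule R hull S"

definition left_noetherian :: "'a::ring_1 set \<Rightarrow> bool" where
  "left_noetherian R \<longleftrightarrow>
     (\<forall>I. I \<subseteq> R \<and> left_submodule R I \<longrightarrow> (\<exists>S. finite S \<and> S \<subseteq> R \<and> I = lspan R S))"


subsection \<open>Free modules\<close>

text \<open>
  Bases are indexed families, not sets: linear independence forces the members with different
  indices to be different.
\<close>

definition left_independent :: "'a::ring_1 set \<Rightarrow> 'i set \<Rightarrow> ('i \<Rightarrow> 'a) \<Rightarrow> bool" where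
  "left_independent R I b \<longleftrightarrow>
     (\<forall>J c. finite J \<and> J \<subseteq> I \<and> (\<forall>j\<in>J. c j \<in> R) \<and> (\<Sum>j\<in>J. c j * b j) = 0 \<longrightarrow> (\<forall>j\<in>J. c j = 0))"

definition left_basis :: "'a::ring_1 set \<Rightarrow> 'i set \<Rightarrow> ('i \<Rightarrow> 'a) \<Rightarrow> 'a set \<Rightarrow> bool" where
  "left_basis R I b M \<longleftrightarrow> left_independent R I b \<and> lspan R (b ` I) = M"

definition free_of_rank :: "'a::ring_1 set \<Rightarrow> 'a set \<Rightarrow> nat \<Rightarrow> bool" where
  "free_of_rank R M m \<longleftrightarrow> (\<exists>b :: nat \<Rightarrow> 'a. left_basis R {..<m} b M)"

text \<open>
  The rank of a finite dimensional free left module; it is unique, for instance, over a left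
  noetherian domain.
\<close>

definition ldim :: "'a::ring_1 set \<Rightarrow> 'a set \<Rightarrow> nat" where
  "ldim R M = (THE m. free_of_rank R M m)"


subsection \<open>Uniform dimension\<close>

definition uniform_module :: "'a::ring_1 set \<Rightarrow> 'a set \<Rightarrow> bool" where
  "uniform_module R U \<longleftrightarrow> left_submodule R U \<and> U \<noteq> {0} \<and>
     (\<forall>L N. left_submodule R L \<and> left_submodule R N \<and> L \<subseteq> U \<and> N \<subseteq> U \<and> L \<noteq> {0} \<and> N \<noteq> {0}
        \<longrightarrow> L \<inter> N \<noteq> {0})"

definition essential_in :: "'a::ring_1 set \<Rightarrow> 'a set \<Rightarrow> 'a set \<Rightarrow> bool" where
  "essential_in R N M \<longleftrightarrow> left_submodule R N \<and> N \<subseteq> M \<and>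
     (\<forall>L. left_submodule R L \<and> L \<subseteq> M \<and> L \<noteq> {0} \<longrightarrow> L \<inter> N \<noteq> {0})"

text \<open>\<open>N\<close> is the internal direct sum of the submodules \<open>U i\<close>, \<open>i < m\<close>.\<close>

definition is_direct_sum :: "'a::ring_1 set \<Rightarrow> nat \<Rightarrow> (nat \<Rightarrow> 'a set) \<Rightarrow> 'a set \<Rightarrow> bool" where
  "is_direct_sum R m U N \<longleftrightarrow>
     (\<forall>i<m. left_submodule R (U i)) \<and> N = lspan R (\<Union>i<m. U i) \<and>
     (\<forall>u. (\<forall>i<m. u i \<in> U i) \<and> (\<Sum>i<m. u i) = 0 \<longrightarrow> (\<forall>i<m. u i = 0))"

definition has_udim :: "'a::ring_1 set \<Rightarrow> 'a set \<Rightarrow> nat \<Rightarrow> bool" where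
  "has_udim R M m \<longleftrightarrow>
     (\<exists>U N. (\<forall>i<m. uniform_module R (U i)) \<and> is_direct_sum R m U N \<and> essential_in R N M)"

definition udim :: "'a::ring_1 set \<Rightarrow> 'a set \<Rightarrow> enat" where
  "udim R M = (if \<exists>m. has_udim R M m then enat (THE m. has_udim R M m) else \<infinity>)"


subsection \<open>Generalized Gelfand-Kirillov dimension\<close>

definition frame :: "'a::ring_1 set \<Rightarrow> 'a set \<Rightarrow> bool" where
  "frame R V \<longleftrightarrow> (\<exists>m. free_of_rank R V m) \<and> 1 \<in> V"

definition frame_power :: "'a::ring_1 set \<Rightarrow> 'a set \<Rightarrow> nat \<Rightarrow> 'a set" where
  "frame_power R V k = lspan R {prod_list vs |vs. length vs = k \<and> set vs \<subseteq> V}"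

text \<open>
  The logarithm to base \<open>k\<close> with its natural values at \<open>0\<close> and \<open>\<infinity>\<close>. The bases \<open>k \<le> 1\<close> are
  meaningless, but do not affect a limit superior for \<open>k \<longlongrightarrow> \<infinity>\<close>.
\<close>

definition elog :: "nat \<Rightarrow> enat \<Rightarrow> ereal" where
  "elog k u = (case u of enat m \<Rightarrow> (if m = 0 then -\<infinity> else ereal (log (real k) (real m))) | \<infinity> \<Rightarrow> \<infinity>)"

text \<open>The frames are submodules of the ambient ring, which is the whole type \<open>'a\<close>.\<close>

definition GGKdim :: "'a::ring_1 set \<Rightarrow> ereal" where
  "GGKdim R = (SUP V\<in>{V. frame R V}. limsup (\<lambda>k. elog k (udim R (frame_power R V k))))"


subsection \<open>Skew PBW extensions\<close>

text \<open>The variables are \<open>x 1, \<dots>, x n\<close>; exponent vectors vanish outside \<open>{1..n}\<close>.\<close>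

definition exponents :: "nat \<Rightarrow> (nat \<Rightarrow> nat) set" where
  "exponents n = {\<alpha>. \<forall>i. i \<notin> {1..n} \<longrightarrow> \<alpha> i = 0}"

definition pbw_monom :: "nat \<Rightarrow> (nat \<Rightarrow> 'a::ring_1) \<Rightarrow> (nat \<Rightarrow> nat) \<Rightarrow> 'a" where
  "pbw_monom n x \<alpha> = prod_list (map (\<lambda>i. x i ^ \<alpha> i) [1..<Suc n])"

definition skew_PBW_extension :: "'a::ring_1 set \<Rightarrow> nat \<Rightarrow> (nat \<Rightarrow> 'a) \<Rightarrow> bool" where
  "skew_PBW_extension R n x \<longleftrightarrow>
     subring_of R \<and>
     left_basis R (exponents n) (pbw_monom n x) UNIV \<and>
     (\<forall>i\<in>{1..n}. \<forall>r\<in>R - {0}. \<exists>c\<in>R - {0}. x i * r - c * x i \<in> R) \<and>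
     (\<forall>i\<in>{1..n}. \<forall>j\<in>{1..n}. \<exists>c\<in>R - {0}.
        x j * x i - c * x i * x j \<in> lspan R (insert 1 (x ` {1..n})))"

definition semigrad :: "'a::ring_1 set \<Rightarrow> nat \<Rightarrow> (nat \<Rightarrow> 'a) \<Rightarrow> nat \<Rightarrow> 'a set" where
  "semigrad R n x k = lspan R {pbw_monom n x \<alpha> |\<alpha>. \<alpha> \<in> exponents n \<and> (\<Sum>i=1..n. \<alpha> i) = k}"

definition gen_hilbert_poly :: "'a::ring_1 set \<Rightarrow> nat \<Rightarrow> (nat \<Rightarrow> 'a) \<Rightarrow> rat poly" where
  "gen_hilbert_poly R n x =
     (THE p. \<forall>\<^sub>F k in sequentially. of_nat (ldim R (semigrad R n x k)) = poly p (of_nat k))"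

end

theory Submission
  imports Defs
begin

text \<open>
  A left noetherian domain \<open>R\<close> is left Ore, and over a left Ore domain Gaussian elimination
  works up to multiplying by nonzero scalars: an independent family is never longer than a
  spanning one (\<open>independent_card_le_spanning\<close>). So ranks of free modules are
  well defined, and in a torsion free module the uniform dimension is just the largest size of
  an independent family (\<open>udim_finite\<close>). In particular it is monotone, and it equals the rank
  on free modules; this turns every dimension in the theorem into a count of monomials.

  The link to the multiplication of \<open>A\<close> is that the submodule \<open>F\<^sub>k\<close> spanned by the ordered monomials
  of degree at most \<open>k\<close> is also spanned by all words of length at most \<open>k\<close> in the variables
  (\<open>wspan_Suc_eq\<close>): by the commutation rules, sorting a word changes it by a scalar factor
  and by shorter words. For words, \<open>F\<^sub>a F\<^sub>b \<subseteq> F\<^bsub>a+b\<^esub>\<close> is clear, since moving a scalar to the left past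
  a variable produces no longer words.

  Every element of \<open>A\<close> lies in some \<open>F\<^sub>d\<close>, so a frame \<open>V\<close>, being finitely generated, does too.
  Then \<open>V\<^sup>k \<subseteq> F\<^bsub>dk\<^esub>\<close>, whose rank is the binomial coefficient of \<open>n + d k\<close> over \<open>n\<close>, and its
  logarithm to base \<open>k\<close> tends to \<open>n\<close> whatever \<open>d\<close> is. Conversely \<open>F\<^sub>1\<close> is a frame whose powers
  contain the independent monomials of degree at most \<open>k\<close>, so \<open>n\<close> is attained. The same binomial
  coefficient with \<open>d = 1\<close> is the sum of the ranks of \<open>A\<^sub>0, \<dots>, A\<^sub>k\<close>, and the rank of \<open>A\<^sub>k\<close> is the
  binomial coefficient of \<open>k + n - 1\<close> over \<open>n - 1\<close>, a polynomial in \<open>k\<close> of degree \<open>n - 1\<close>.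
\<close>

section \<open>Spans over a noncommutative subring\<close>

lemma left_submodule_lspan: "left_submodule R (lspan R S)"
  unfolding lspan_def hull_def left_submodule_def by blast

lemma lspan_superset: "S \<subseteq> lspan R S"
  unfolding lspan_def by (rule hull_subset)

lemma lspan_base: "s \<in> S \<Longrightarrow> s \<in> lspan R S"
  using lspan_superset by blast

lemma lspan_least: "S \<subseteq> M \<Longrightarrow> left_submodule R M \<Longrightarrow> lspan R S \<subseteq> M"
  unfolding lspan_def by (rule hull_minimal)

lemma lspan_mono: "S \<subseteq> T \<Longrightarrow> lspan R S \<subseteq> lspan R T"
  unfolding lspan_def by (rule hull_mono)

lemma left_submodule_zero: "left_submodule R M \<Longrightarrow> 0 \<in> M"
  and left_submodule_add: "left_submodule R M \<Longrightarrow> u \<in> M \<Longrightarrow> v \<in> M \<Longrightarrow> u + v \<in> M"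
  and left_submodule_scale: "left_submodule R M \<Longrightarrow> r \<in> R \<Longrightarrow> v \<in> M \<Longrightarrow> r * v \<in> M"
  by (auto simp: left_submodule_def)

lemma left_submodule_sum:
  assumes "left_submodule R M" "\<And>j. j \<in> J \<Longrightarrow> f j \<in> M"
  shows "sum f J \<in> M"
  using assms(2)
  by (induction J rule: infinite_finite_induct)
     (auto intro: left_submodule_zero left_submodule_add assms(1))

lemma left_independentD:
  assumes "left_independent R I v" "finite J" "J \<subseteq> I" "\<And>j. j \<in> J \<Longrightarrow> c j \<in> R"
    and "(\<Sum>j\<in>J. c j * v j) = 0" "j \<in> J"
  shows "c j = 0"
  using assms unfolding left_independent_def by blast

lemma left_independent_subset:
  "left_independent R I v \<Longrightarrow> J \<subseteq> I \<Longrightarrow> left_independent R J v"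
  unfolding left_independent_def by (meson subset_trans)

locale scalar_subring =
  fixes R :: "'a::ring_1 set"
  assumes subring: "subring_of R"
begin

lemma R_one: "1 \<in> R"
  and R_diff: "a \<in> R \<Longrightarrow> b \<in> R \<Longrightarrow> a - b \<in> R"
  and R_mult: "a \<in> R \<Longrightarrow> b \<in> R \<Longrightarrow> a * b \<in> R"
  using subring by (auto simp: subring_of_def)

lemma R_zero: "0 \<in> R"
  using R_diff[OF R_one R_one] by simp

lemma R_uminus: "a \<in> R \<Longrightarrow> - a \<in> R"
  using R_diff[OF R_zero] by simp

lemma R_add: "a \<in> R \<Longrightarrow> b \<in> R \<Longrightarrow> a + b \<in> R"
  using R_diff[of a "- b"] R_uminus by simp

lemma left_submodule_R: "left_submodule R R"
  by (auto simp: left_submodule_def R_zero R_add R_mult)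

lemma R_sum: "(\<And>j. j \<in> J \<Longrightarrow> f j \<in> R) \<Longrightarrow> sum f J \<in> R"
  by (rule left_submodule_sum[OF left_submodule_R])

lemma left_submodule_uminus: "left_submodule R M \<Longrightarrow> u \<in> M \<Longrightarrow> - u \<in> M"
  using left_submodule_scale[of R M "-1" u] R_uminus[OF R_one] by simp

lemma left_submodule_diff: "left_submodule R M \<Longrightarrow> u \<in> M \<Longrightarrow> v \<in> M \<Longrightarrow> u - v \<in> M"
  using left_submodule_add[of R M u "- v"] left_submodule_uminus by simp

lemma left_submodule_multiples: "left_submodule R {r * v |r. r \<in> R}"
  unfolding left_submodule_def
proof (intro conjI ballI)
  show "0 \<in> {r * v |r. r \<in> R}" using R_zero by force
  fix u w assume "u \<in> {r * v |r. r \<in> R}" "w \<in> {r * v |r. r \<in> R}"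
  then show "u + w \<in> {r * v |r. r \<in> R}"
    using R_add by (auto simp: distrib_right[symmetric])
next
  fix r u assume "r \<in> R" "u \<in> {r * v |r. r \<in> R}"
  then show "r * u \<in> {r * v |r. r \<in> R}"
    using R_mult by (auto simp: mult.assoc[symmetric])
qed

lemma lspan_familyI:
  assumes "J \<subseteq> I" "\<And>j. j \<in> J \<Longrightarrow> c j \<in> R"
  shows "(\<Sum>j\<in>J. c j * e j) \<in> lspan R (e ` I)"
  using assms
  by (intro left_submodule_sum[OF left_submodule_lspan]
      left_submodule_scale[OF left_submodule_lspan] lspan_base) auto

lemma lspan_family_iff:
  "y \<in> lspan R (e ` I) \<longleftrightarrow>
     (\<exists>J c. finite J \<and> J \<subseteq> I \<and> (\<forall>j\<in>J. c j \<in> R) \<and> y = (\<Sum>j\<in>J. c j * e j))"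
proof
  let ?M = "{y. \<exists>J c. finite J \<and> J \<subseteq> I \<and> (\<forall>j\<in>J. c j \<in> R) \<and> y = (\<Sum>j\<in>J. c j * e j)}"
  have "left_submodule R ?M"
    unfolding left_submodule_def
  proof (intro conjI ballI)
    show "0 \<in> ?M" by (rule CollectI, rule exI[of _ "{}"]) simp
  next
    fix u w assume "u \<in> ?M" "w \<in> ?M"
    then obtain J c K d where *: "finite J" "J \<subseteq> I" "\<forall>j\<in>J. c j \<in> R" "u = (\<Sum>j\<in>J. c j * e j)"
      "finite K" "K \<subseteq> I" "\<forall>j\<in>K. d j \<in> R" "w = (\<Sum>j\<in>K. d j * e j)" by blast
    define f where "f j = (if j \<in> J then c j else 0) + (if j \<in> K then d j else 0)" for j
    have "(\<Sum>j\<in>J\<union>K. f j * e j) =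
        (\<Sum>j\<in>J\<union>K. (if j \<in> J then c j * e j else 0)) + (\<Sum>j\<in>J\<union>K. (if j \<in> K then d j * e j else 0))"
      by (simp add: f_def distrib_right sum.distrib[symmetric] if_distrib[of "\<lambda>r. r * _"] cong: if_cong)
    also have "\<dots> = u + w"
      using *(1,5) by (simp add: *(4,8) sum.inter_restrict[symmetric] Int_absorb1 Int_absorb2)
    finally have "u + w = (\<Sum>j\<in>J\<union>K. f j * e j)" ..
    moreover have "\<forall>j\<in>J\<union>K. f j \<in> R" using * by (auto simp: f_def R_zero R_add)
    ultimately show "u + w \<in> ?M" using * by (intro CollectI exI[of _ "J \<union> K"] exI[of _ f]) auto
  next
    fix r u assume r: "r \<in> R" and "u \<in> ?M"
    then obtain J c where *: "finite J" "J \<subseteq> I" "\<forall>j\<in>J. c j \<in> R" "u = (\<Sum>j\<in>J. c j * e j)" by blast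
    then have "r * u = (\<Sum>j\<in>J. (r * c j) * e j)" by (simp add: sum_distrib_left mult.assoc)
    then show "r * u \<in> ?M" using * r R_mult
      by (intro CollectI exI[of _ J] exI[of _ "\<lambda>j. r * c j"]) auto
  qed
  moreover have "e ` I \<subseteq> ?M"
  proof
    fix y assume "y \<in> e ` I"
    then obtain i where "i \<in> I" "y = e i" by blast
    then show "y \<in> ?M"
      using R_one by (intro CollectI exI[of _ "{i}"] exI[of _ "\<lambda>_. 1"]) auto
  qed
  ultimately have sub: "lspan R (e ` I) \<subseteq> ?M" by (rule lspan_least[rotated])
  assume "y \<in> lspan R (e ` I)"
  then have "y \<in> ?M" by (rule subsetD[OF sub])
  then show "\<exists>J c. finite J \<and> J \<subseteq> I \<and> (\<forall>j\<in>J. c j \<in> R) \<and> y = (\<Sum>j\<in>J. c j * e j)"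
    by (rule CollectD)
next
  assume "\<exists>J c. finite J \<and> J \<subseteq> I \<and> (\<forall>j\<in>J. c j \<in> R) \<and> y = (\<Sum>j\<in>J. c j * e j)"
  then show "y \<in> lspan R (e ` I)" using lspan_familyI by blast
qed

lemma lspan_finite_familyE:
  assumes "finite E" "y \<in> lspan R (e ` E)"
  obtains c where "\<And>j. c j \<in> R" "y = (\<Sum>j\<in>E. c j * e j)"
proof -
  obtain J c where *: "finite J" "J \<subseteq> E" "\<forall>j\<in>J. c j \<in> R" "y = (\<Sum>j\<in>J. c j * e j)"
    using assms(2) unfolding lspan_family_iff by blast
  have "y = (\<Sum>j\<in>E. (if j \<in> J then c j else 0) * e j)"
    unfolding *(4) using * assms(1) by (intro sum.mono_neutral_cong_left) auto
  with *(3) R_zero show ?thesis by (intro that[of "\<lambda>j. if j \<in> J then c j else 0"]) auto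
qed

text \<open>For a finite index set a relation may be taken over the whole index set.\<close>

lemma left_independent_finite:
  assumes "finite I"
  shows "left_independent R I v \<longleftrightarrow>
    (\<forall>c. (\<forall>i\<in>I. c i \<in> R) \<and> (\<Sum>i\<in>I. c i * v i) = 0 \<longrightarrow> (\<forall>i\<in>I. c i = 0))"
    (is "_ \<longleftrightarrow> ?rhs")
proof
  assume ?rhs
  show "left_independent R I v"
    unfolding left_independent_def
  proof (intro allI impI, elim conjE)
    fix J c assume *: "finite J" "J \<subseteq> I" "\<forall>j\<in>J. c j \<in> R" "(\<Sum>j\<in>J. c j * v j) = 0"
    define d where "d i = (if i \<in> J then c i else 0)" for i
    have "(\<Sum>i\<in>I. d i * v i) = 0"
      unfolding *(4)[symmetric] using * assms
      by (intro sum.mono_neutral_cong_right) (auto simp: d_def)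
    moreover have "\<forall>i\<in>I. d i \<in> R" using * R_zero by (auto simp: d_def)
    ultimately have "\<forall>i\<in>I. d i = 0" using \<open>?rhs\<close> by blast
    then show "\<forall>j\<in>J. c j = 0" using *(2) by (metis d_def subsetD)
  qed
next
  assume "left_independent R I v"
  then show ?rhs using assms unfolding left_independent_def by blast
qed

lemma left_independent_nonzero:
  assumes "left_independent R I v" "i \<in> I"
  shows "v i \<noteq> 0"
proof
  assume "v i = 0"
  then have "(1::'a) = 0"
    using left_independentD[OF assms(1), of "{i}" "\<lambda>_. 1" i] assms(2) R_one by simp
  then show False by simp
qed

end

lemma left_independent_reindex:
  assumes "left_independent R I v" "inj_on f K" "f ` K \<subseteq> I"
  shows "left_independent R K (v \<circ> f)"
  unfolding left_independent_def
proof (intro allI impI, elim conjE)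
  fix J c assume *: "finite J" "J \<subseteq> K" "\<forall>j\<in>J. c j \<in> R" "(\<Sum>j\<in>J. c j * (v \<circ> f) j) = 0"
  have inj: "inj_on f J" using assms(2) *(2) by (rule inj_on_subset)
  define d where "d = c \<circ> the_inv_into J f"
  have d: "d (f j) = c j" if "j \<in> J" for j using that inj by (simp add: d_def the_inv_into_f_f)
  have "(\<Sum>i\<in>f ` J. d i * v i) = 0"
    using inj d *(4) by (simp add: sum.reindex cong: sum.cong)
  moreover have "f ` J \<subseteq> I" using assms(3) *(2) by blast
  moreover have "d i \<in> R" if "i \<in> f ` J" for i using that d *(3) by auto
  ultimately have "d i = 0" if "i \<in> f ` J" for i
    using left_independentD[OF assms(1) finite_imageI[OF *(1)]] that by blast
  then show "\<forall>j\<in>J. c j = 0" using d by auto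
qed

lemma free_of_rank_card_basis:
  assumes "finite I" "left_basis R I b M"
  shows "free_of_rank R M (card I)"
proof -
  obtain f where f: "bij_betw f {..<card I} I"
    using ex_bij_betw_nat_finite[OF assms(1)] by (auto simp: atLeast0LessThan)
  then have "(b \<circ> f) ` {..<card I} = b ` I" by (metis bij_betw_def image_comp)
  moreover have "left_independent R {..<card I} (b \<circ> f)"
    using assms(2) f by (intro left_independent_reindex[of R I]) (auto simp: bij_betw_def left_basis_def)
  ultimately have "left_basis R {..<card I} (b \<circ> f) M"
    using assms(2) by (simp add: left_basis_def)
  then show ?thesis unfolding free_of_rank_def by blast
qed


section \<open>Ranks over a left Ore domain\<close>

text \<open>
  If \<open>R a\<close> and \<open>R b\<close> met only in \<open>0\<close>, the elements \<open>b, b a, b a\<^sup>2, \<dots>\<close> would be independent: in a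
  relation all terms but the first are left multiples of \<open>a\<close>, so the first coefficient
  vanishes, and \<open>a\<close> can be cancelled from the rest. They would span a left ideal that is not
  finitely generated.
\<close>

lemma left_noetherian_domain_ore:
  assumes sub: "subring_of R" and noeth: "left_noetherian R" and dom: "is_domain R"
    and a: "a \<in> R" and b: "b \<in> R" and "b \<noteq> 0"
  shows "\<exists>s\<in>R. \<exists>t\<in>R. s \<noteq> 0 \<and> s * a = t * b"
proof (rule ccontr)
  interpret scalar_subring R by unfold_locales (rule sub)
  assume "\<not> ?thesis"
  then have no: "s = 0" if "s \<in> R" "t \<in> R" "s * a = t * b" for s t using that by blast
  have "a \<noteq> 0" using no[of 1 0] R_one R_zero by auto
  have pow: "a ^ i \<in> R" for i by (induction i) (auto intro: R_one R_mult a)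
  have ba: "b * a ^ i \<in> R" for i using b pow R_mult by blast
  have indep: "\<forall>i\<le>k. c i = 0"
    if "\<And>i. c i \<in> R" "(\<Sum>i\<le>k. c i * (b * a ^ i)) = 0" for k and c :: "nat \<Rightarrow> 'a"
    using that
  proof (induction k arbitrary: c)
    case 0
    then have "c 0 = 0" using dom b \<open>b \<noteq> 0\<close> by (auto simp: is_domain_def)
    then show ?case by simp
  next
    case (Suc k)
    define s where "s = (\<Sum>i\<le>k. c (Suc i) * (b * a ^ i))"
    have sR: "s \<in> R" unfolding s_def by (intro R_sum R_mult Suc.prems ba)
    have "(\<Sum>i\<le>Suc k. c i * (b * a ^ i)) = c 0 * b + s * a"
      unfolding sum.atMost_Suc_shift s_def
      by (simp add: sum_distrib_right mult.assoc power_commutes)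
    then have eq: "s * a = (- c 0) * b" using Suc.prems(2) by (simp add: eq_neg_iff_add_eq_0 add.commute)
    then have "s = 0" using no[OF sR _ eq] R_uminus Suc.prems(1) by blast
    then have "c 0 * b = 0" using eq by simp
    then have "c 0 = 0" using dom b \<open>b \<noteq> 0\<close> Suc.prems(1) by (auto simp: is_domain_def)
    moreover have "\<forall>i\<le>k. c (Suc i) = 0"
      using Suc.IH[of "\<lambda>i. c (Suc i)"] Suc.prems(1) \<open>s = 0\<close> by (simp add: s_def)
    ultimately show ?case by (metis Suc_le_mono not0_implies_Suc)
  qed
  define I where "I = lspan R (range (\<lambda>i. b * a ^ i))"
  have "I \<subseteq> R" unfolding I_def by (rule lspan_least[OF _ left_submodule_R]) (auto intro: ba)
  moreover have "left_submodule R I" unfolding I_def by (rule left_submodule_lspan)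
  ultimately obtain S where S: "finite S" "I = lspan R S"
    using noeth unfolding left_noetherian_def by blast
  have "\<exists>k. s \<in> lspan R ((\<lambda>i. b * a ^ i) ` {..k})" if "s \<in> S" for s
  proof -
    have "s \<in> I" using that S lspan_base by blast
    then obtain J c where *: "finite J" "\<forall>j\<in>J. c j \<in> R" "s = (\<Sum>j\<in>J. c j * (b * a ^ j))"
      unfolding I_def lspan_family_iff by blast
    then have "J \<subseteq> {..Max J}" by auto
    then show ?thesis using * unfolding lspan_family_iff by blast
  qed
  then obtain K where K: "s \<in> lspan R ((\<lambda>i. b * a ^ i) ` {..K s})" if "s \<in> S" for s by metis
  define k where "k = Max (insert 0 (K ` S))"
  have "S \<subseteq> lspan R ((\<lambda>i. b * a ^ i) ` {..k})"
  proof
    fix s assume "s \<in> S"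
    then have "{..K s} \<subseteq> {..k}" using S(1) by (auto simp: k_def intro: order_trans)
    then show "s \<in> lspan R ((\<lambda>i. b * a ^ i) ` {..k})"
      using K[OF \<open>s \<in> S\<close>] lspan_mono[OF image_mono] by blast
  qed
  then have "I \<subseteq> lspan R ((\<lambda>i. b * a ^ i) ` {..k})"
    unfolding S(2) by (rule lspan_least[OF _ left_submodule_lspan])
  moreover have "b * a ^ Suc k \<in> I" unfolding I_def by (intro lspan_base rangeI)
  ultimately have "b * a ^ Suc k \<in> lspan R ((\<lambda>i. b * a ^ i) ` {..k})" by blast
  then obtain c where c: "\<And>j. c j \<in> R" "b * a ^ Suc k = (\<Sum>j\<le>k. c j * (b * a ^ j))"
    using lspan_finite_familyE[of "{..k}" _ "\<lambda>i. b * a ^ i"] by blast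
  define d where "d i = (if i = Suc k then - 1 else c i)" for i
  have "d i \<in> R" for i using c R_one R_uminus by (auto simp: d_def)
  moreover have "(\<Sum>i\<le>Suc k. d i * (b * a ^ i)) = 0"
    using c(2) by (simp add: d_def)
  ultimately have "\<forall>i\<le>Suc k. d i = 0" by (rule indep)
  then show False by (auto simp: d_def)
qed

text \<open>
  The ambient ring is torsion free as a left \<open>R\<close>-module; as it contains \<open>R\<close>, this makes \<open>R\<close> a domain.
\<close>

locale ore_torsion_free = scalar_subring +
  assumes ore: "a \<in> R \<Longrightarrow> b \<in> R \<Longrightarrow> b \<noteq> 0 \<Longrightarrow> \<exists>s\<in>R. \<exists>t\<in>R. s \<noteq> 0 \<and> s * a = t * b"
    and torsion_free: "r \<in> R \<Longrightarrow> r * y = 0 \<Longrightarrow> r = 0 \<or> y = 0"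
begin

text \<open>
  Gaussian elimination: common left multiples of coefficients replace division by a pivot. Each
  remaining vector is multiplied by a nonzero scalar, which preserves independence because
  \<open>R\<close> has no zero divisors.
\<close>

lemma independent_card_le_spanning:
  assumes "finite E" "finite I" "left_independent R I v" "\<And>i. i \<in> I \<Longrightarrow> v i \<in> lspan R (e ` E)"
  shows "card I \<le> card E"
  using assms
proof (induction E arbitrary: I v)
  case empty
  have "lspan R {} \<subseteq> {0::'a}" by (rule lspan_least) (auto simp: left_submodule_def)
  then have "v i = 0" if "i \<in> I" for i using empty.prems(3)[OF that] by auto
  then have "I = {}" using left_independent_nonzero[OF empty.prems(2)] by blast
  then show ?case by simp
next
  case (insert p E)
  have "\<exists>a\<in>R. \<exists>u\<in>lspan R (e ` E). v i = a * e p + u" if i: "i \<in> I" for i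
  proof -
    obtain c where c: "\<And>j. c j \<in> R" "v i = (\<Sum>j\<in>insert p E. c j * e j)"
      using lspan_finite_familyE[of "insert p E" "v i" e] insert.prems(3)[OF i] insert.hyps(1)
      by (metis finite_insert)
    have "(\<Sum>j\<in>E. c j * e j) \<in> lspan R (e ` E)"
      by (rule lspan_familyI) (auto intro: c)
    then show ?thesis using c insert.hyps by auto
  qed
  then obtain a u where au: "\<And>i. i \<in> I \<Longrightarrow> a i \<in> R" "\<And>i. i \<in> I \<Longrightarrow> u i \<in> lspan R (e ` E)"
    "\<And>i. i \<in> I \<Longrightarrow> v i = a i * e p + u i" by metis
  show ?case
  proof (cases "\<forall>i\<in>I. a i = 0")
    case True
    then have "card I \<le> card E"
      using insert.IH[OF insert.prems(1,2)] au by simp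
    then show ?thesis using insert.hyps by simp
  next
    case False
    then obtain q where q: "q \<in> I" "a q \<noteq> 0" by blast
    have "\<exists>s\<in>R. \<exists>t\<in>R. s \<noteq> 0 \<and> s * a i = t * a q" if "i \<in> I" for i
      using ore au(1) q that by blast
    then obtain s t where st: "\<And>i. i \<in> I \<Longrightarrow> s i \<in> R" "\<And>i. i \<in> I \<Longrightarrow> t i \<in> R"
      "\<And>i. i \<in> I \<Longrightarrow> s i \<noteq> 0" "\<And>i. i \<in> I \<Longrightarrow> s i * a i = t i * a q" by metis
    \<comment> \<open>Eliminate the generator with index \<open>p\<close> from all vectors but the pivot.\<close>
    define w where "w i = s i * v i - t i * v q" for i
    have w: "w i \<in> lspan R (e ` E)" if "i \<in> I - {q}" for i
    proof -
      have "w i = s i * u i - t i * u q"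
        using that au(3) q st(4)[of i]
        by (simp add: w_def distrib_left mult.assoc[symmetric])
      then show ?thesis
        using that q au st
        by (auto intro!: left_submodule_diff left_submodule_lspan
            left_submodule_scale[OF left_submodule_lspan])
    qed
    have "left_independent R (I - {q}) w"
      unfolding left_independent_finite[OF finite_Diff[OF insert.prems(1)]]
    proof (intro allI impI, elim conjE)
      fix c assume c: "\<forall>i\<in>I - {q}. c i \<in> R" "(\<Sum>i\<in>I - {q}. c i * w i) = 0"
      define d where "d i = (if i = q then - (\<Sum>i\<in>I - {q}. c i * t i) else c i * s i)" for i
      have dR: "\<forall>i\<in>I. d i \<in> R"
        unfolding d_def using c st by (auto intro!: R_uminus R_sum R_mult)
      have "(\<Sum>i\<in>I. d i * v i) = d q * v q + (\<Sum>i\<in>I - {q}. d i * v i)"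
        using q insert.prems(1) by (simp add: sum.remove)
      also have "\<dots> = (\<Sum>i\<in>I - {q}. c i * s i * v i) - (\<Sum>i\<in>I - {q}. c i * t i) * v q"
        by (simp add: d_def)
      also have "\<dots> = (\<Sum>i\<in>I - {q}. c i * w i)"
        by (simp add: w_def sum_distrib_right right_diff_distrib sum_subtractf mult.assoc)
      finally have "(\<Sum>i\<in>I. d i * v i) = 0" using c(2) by simp
      then have d0: "\<forall>i\<in>I. d i = 0"
        using dR insert.prems(2) left_independent_finite[OF insert.prems(1)] by blast
      show "\<forall>i\<in>I - {q}. c i = 0"
      proof
        fix i assume i: "i \<in> I - {q}"
        then have "c i * s i = 0" using d0 by (auto simp: d_def)
        then show "c i = 0" using torsion_free c(1) st(3) i by blast
      qed
    qed
    then have "card (I - {q}) \<le> card E"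
      using insert.IH[of "I - {q}" w] insert.prems(1) w by auto
    then show ?thesis using q insert by (simp add: card_Diff_singleton)
  qed
qed

lemma ldim_eq_card_basis:
  assumes "finite I" "left_basis R I b M"
  shows "ldim R M = card I"
proof -
  have ex: "free_of_rank R M (card I)" by (rule free_of_rank_card_basis[OF assms])
  have le: "m \<le> m'" if fr: "free_of_rank R M m" "free_of_rank R M m'" for m m'
  proof -
    obtain b b' where *: "left_basis R {..<m} b M" "left_basis R {..<m'} b' M"
      using fr unfolding free_of_rank_def by blast
    have "b i \<in> lspan R (b' ` {..<m'})" if "i < m" for i
      using * that lspan_base[of "b i" "b ` {..<m}" R] by (auto simp: left_basis_def)
    then show ?thesis
      using independent_card_le_spanning[of "{..<m'}" "{..<m}" b b'] *(1)
      by (auto simp: left_basis_def)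
  qed
  show ?thesis unfolding ldim_def
  proof (rule the_equality)
    show "free_of_rank R M (card I)" by (rule ex)
    show "m = card I" if "free_of_rank R M m" for m
      using le[OF that ex] le[OF ex that] by (rule order_antisym)
  qed
qed

text \<open>
  The Ore condition makes the elements with a nonzero multiple in \<open>M\<close> into a submodule.
\<close>

lemma left_submodule_saturation:
  assumes M: "left_submodule R M"
  shows "left_submodule R {y. \<exists>s\<in>R - {0}. s * y \<in> M}"
  unfolding left_submodule_def
proof (intro conjI ballI)
  let ?C = "{y. \<exists>s\<in>R - {0}. s * y \<in> M}"
  show "0 \<in> ?C" using R_one left_submodule_zero[OF M] by (auto intro!: bexI[of _ 1])
next
  let ?C = "{y. \<exists>s\<in>R - {0}. s * y \<in> M}"
  fix u v assume "u \<in> ?C" "v \<in> ?C"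
  then obtain p q where p: "p \<in> R" "p \<noteq> 0" "p * u \<in> M" and q: "q \<in> R" "q \<noteq> 0" "q * v \<in> M" by blast
  obtain s t where st: "s \<in> R" "t \<in> R" "s \<noteq> 0" "s * p = t * q" using ore p q by blast
  have "s * p * (u + v) = s * (p * u) + t * (q * v)"
    using st(4) by (simp add: distrib_left mult.assoc[symmetric])
  then have "s * p * (u + v) \<in> M"
    using M p q st by (auto intro: left_submodule_add left_submodule_scale)
  moreover have "s * p \<in> R - {0}" using st p R_mult torsion_free by blast
  ultimately show "u + v \<in> ?C" by blast
next
  let ?C = "{y. \<exists>s\<in>R - {0}. s * y \<in> M}"
  fix r u assume "r \<in> R" "u \<in> ?C"
  then obtain p where p: "p \<in> R" "p \<noteq> 0" "p * u \<in> M" by blast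
  obtain s t where st: "s \<in> R" "t \<in> R" "s \<noteq> 0" "s * r = t * p" using ore p \<open>r \<in> R\<close> by blast
  have "s * (r * u) = t * (p * u)" using st(4) by (simp add: mult.assoc[symmetric])
  then have "s * (r * u) \<in> M" using M p st by (auto intro: left_submodule_scale)
  then show "r * u \<in> ?C" using st by blast
qed

lemma uniform_module_common_multiple:
  assumes "uniform_module R U" "y \<in> U" "y \<noteq> 0" "z \<in> U" "z \<noteq> 0"
  obtains s r where "s \<in> R" "r \<in> R" "s * y = r * z" "s * y \<noteq> 0"
proof -
  let ?m = "\<lambda>w. {r * w |r. r \<in> R}"
  have U: "left_submodule R U" using assms(1) by (simp add: uniform_module_def)
  have sub: "?m w \<subseteq> U" if "w \<in> U" for w using left_submodule_scale[OF U _ that] by blast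
  have "1 * w \<in> ?m w" for w using R_one by blast
  then have nz: "?m w \<noteq> {0}" if "w \<noteq> 0" for w using that by auto
  have "?m y \<inter> ?m z \<noteq> {0}"
    using assms(1) left_submodule_multiples[of y] left_submodule_multiples[of z]
      sub[OF assms(2)] sub[OF assms(4)] nz[OF assms(3)] nz[OF assms(5)]
    unfolding uniform_module_def by simp
  moreover have "0 \<in> ?m y \<inter> ?m z"
    using left_submodule_zero[OF left_submodule_multiples] by blast
  ultimately obtain u where "u \<in> ?m y" "u \<in> ?m z" "u \<noteq> 0" by blast
  then show ?thesis using that by auto
qed

text \<open>
  Choosing a nonzero element in each of the uniform summands gives an independent family. By
  uniformity, its span meets every nonzero cyclic submodule of a summand, and saturation carries
  this over to the direct sum and, by essentiality, to \<open>M\<close>.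
\<close>

lemma has_udim_independent:
  assumes "has_udim R M m" and M: "left_submodule R M"
  obtains v where "left_independent R {..<m} v" "v ` {..<m} \<subseteq> M"
    "\<And>y. y \<in> M \<Longrightarrow> \<exists>s\<in>R - {0}. s * y \<in> lspan R (v ` {..<m})"
proof -
  obtain U N where uni: "\<And>i. i < m \<Longrightarrow> uniform_module R (U i)"
    and ds: "is_direct_sum R m U N" and ess: "essential_in R N M"
    using assms(1) unfolding has_udim_def by blast
  have U: "left_submodule R (U i)" if "i < m" for i
    using ds that by (auto simp: is_direct_sum_def)
  have "\<exists>y. y \<in> U i \<and> y \<noteq> 0" if "i < m" for i
    using uni[OF that] left_submodule_zero[OF U[OF that]] by (auto simp: uniform_module_def)
  then obtain v where v: "\<And>i. i < m \<Longrightarrow> v i \<in> U i" "\<And>i. i < m \<Longrightarrow> v i \<noteq> 0" by metis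
  have UN: "U i \<subseteq> N" if "i < m" for i
    using ds that lspan_superset[of "\<Union>i<m. U i" R] by (auto simp: is_direct_sum_def)
  have NM: "N \<subseteq> M" using ess by (simp add: essential_in_def)
  have "left_independent R {..<m} v"
    unfolding left_independent_finite[OF finite_lessThan]
  proof (intro allI impI, elim conjE)
    fix c assume c: "\<forall>i\<in>{..<m}. c i \<in> R" "(\<Sum>i<m. c i * v i) = 0"
    have summand: "c i * v i \<in> U i" if "i < m" for i
      using that c(1) v(1) by (intro left_submodule_scale[OF U]) auto
    have zero: "u i = 0" if "\<And>i. i < m \<Longrightarrow> u i \<in> U i" "(\<Sum>i<m. u i) = 0" "i < m" for u i
      using ds that by (simp add: is_direct_sum_def)
    have "c i * v i = 0" if "i < m" for i
      using zero[of "\<lambda>i. c i * v i" i] summand that c(2) by simp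
    then show "\<forall>i\<in>{..<m}. c i = 0" using torsion_free v(2) c(1) by blast
  qed
  moreover have "v ` {..<m} \<subseteq> M" using v UN NM by blast
  moreover have "\<exists>s\<in>R - {0}. s * y \<in> lspan R (v ` {..<m})" if "y \<in> M" for y
  proof -
    let ?L = "lspan R (v ` {..<m})"
    let ?C = "{y. \<exists>s\<in>R - {0}. s * y \<in> ?L}"
    have "U i \<subseteq> ?C" if i: "i < m" for i
    proof
      fix y assume y: "y \<in> U i"
      show "y \<in> ?C"
      proof (cases "y = 0")
        case True
        then show ?thesis
          using left_submodule_zero[OF left_submodule_saturation[OF left_submodule_lspan]] by blast
      next
        case False
        then obtain s r where sr: "s \<in> R" "r \<in> R" "s * y = r * v i" "s * y \<noteq> 0"
          using uniform_module_common_multiple[OF uni[OF i] y _ v(1)[OF i] v(2)[OF i]] by blast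
        then have "s * y \<in> ?L"
          using i by (auto intro: left_submodule_scale[OF left_submodule_lspan] lspan_base)
        moreover have "s \<noteq> 0" using sr by auto
        ultimately show ?thesis using sr by blast
      qed
    qed
    then have "(\<Union>i<m. U i) \<subseteq> ?C" by blast
    then have "lspan R (\<Union>i<m. U i) \<subseteq> ?C"
      by (rule lspan_least[OF _ left_submodule_saturation[OF left_submodule_lspan]])
    then have NC: "N \<subseteq> ?C" using ds by (simp add: is_direct_sum_def)
    show ?thesis
    proof (cases "y = 0")
      case True
      then show ?thesis
        using left_submodule_zero[OF left_submodule_saturation[OF left_submodule_lspan]] by blast
    next
      case False
      have "y \<in> {r * y |r. r \<in> R}" using R_one by force
      then have "{r * y |r. r \<in> R} \<inter> N \<noteq> {0}"
        using ess False \<open>y \<in> M\<close> left_submodule_multiples[of y] left_submodule_scale[OF M]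
        unfolding essential_in_def by blast
      moreover have "0 \<in> {r * y |r. r \<in> R} \<inter> N"
        using ess left_submodule_zero left_submodule_multiples unfolding essential_in_def by blast
      ultimately obtain r where r: "r \<in> R" "r * y \<in> N" "r * y \<noteq> 0" by blast
      then obtain s where s: "s \<in> R - {0}" "s * (r * y) \<in> lspan R (v ` {..<m})" using NC by blast
      have "s * r \<noteq> 0" using r s torsion_free by fastforce
      then show ?thesis
        using r s R_mult by (intro bexI[of _ "s * r"]) (auto simp: mult.assoc)
    qed
  qed
  ultimately show ?thesis by (rule that)
qed

text \<open>
  Multiplying each \<open>w i\<close> by a suitable nonzero scalar moves the family into the span of \<open>m\<close>
  elements without destroying its independence.
\<close>

lemma has_udim_bounds_independent:
  assumes "has_udim R M m" "left_submodule R M"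
    and "finite I" "left_independent R I w" "w ` I \<subseteq> M"
  shows "card I \<le> m"
proof -
  obtain v where v: "left_independent R {..<m} v" "v ` {..<m} \<subseteq> M"
    "\<And>y. y \<in> M \<Longrightarrow> \<exists>s\<in>R - {0}. s * y \<in> lspan R (v ` {..<m})"
    using has_udim_independent[OF assms(1,2)] by blast
  have "\<exists>s\<in>R - {0}. s * w i \<in> lspan R (v ` {..<m})" if "i \<in> I" for i
    using v(3) assms(5) that by blast
  then obtain s where s: "\<And>i. i \<in> I \<Longrightarrow> s i \<in> R - {0}"
    "\<And>i. i \<in> I \<Longrightarrow> s i * w i \<in> lspan R (v ` {..<m})" by metis
  have "left_independent R I (\<lambda>i. s i * w i)"
    unfolding left_independent_finite[OF assms(3)]
  proof (intro allI impI ballI, elim conjE)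
    fix c i assume c: "\<forall>i\<in>I. c i \<in> R" "(\<Sum>i\<in>I. c i * (s i * w i)) = 0" and i: "i \<in> I"
    have "c i * s i = 0"
      by (rule left_independentD[OF assms(4,3) order_refl _ _ i])
        (use c s R_mult in \<open>auto simp: mult.assoc\<close>)
    then show "c i = 0" using torsion_free c(1) s(1) i by blast
  qed
  from independent_card_le_spanning[OF _ assms(3) this s(2)] show ?thesis by simp
qed

lemma has_udim_unique:
  assumes "has_udim R M m" "has_udim R M m'" "left_submodule R M"
  shows "m = m'"
proof -
  have "k \<le> l" if kl: "has_udim R M k" "has_udim R M l" for k l
  proof -
    obtain v where "left_independent R {..<k} v" "v ` {..<k} \<subseteq> M"
      using has_udim_independent[OF kl(1) assms(3)] by metis
    from has_udim_bounds_independent[OF kl(2) assms(3) _ this] show ?thesis by simp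
  qed
  from this[OF assms(1,2)] this[OF assms(2,1)] show ?thesis by (rule order_antisym)
qed

lemma uniform_module_multiples:
  assumes "v \<noteq> 0"
  shows "uniform_module R {r * v |r. r \<in> R}"
  unfolding uniform_module_def
proof (intro conjI allI impI; (elim conjE)?)
  show "left_submodule R {r * v |r. r \<in> R}" by (rule left_submodule_multiples)
  have "1 * v \<in> {r * v |r. r \<in> R}" using R_one by blast
  then show "{r * v |r. r \<in> R} \<noteq> {0}" using assms by auto
next
  fix L N assume L: "left_submodule R L" "L \<subseteq> {r * v |r. r \<in> R}" "L \<noteq> {0}"
    and N: "left_submodule R N" "N \<subseteq> {r * v |r. r \<in> R}" "N \<noteq> {0}"
  obtain a where a: "a \<in> R" "a * v \<in> L" "a * v \<noteq> 0" using L left_submodule_zero[OF L(1)] by blast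
  obtain b where b: "b \<in> R" "b * v \<in> N" "b * v \<noteq> 0" using N left_submodule_zero[OF N(1)] by blast
  obtain s t where st: "s \<in> R" "t \<in> R" "s \<noteq> 0" "s * a = t * b" using ore a b by force
  have "s * (a * v) = t * (b * v)" using st(4) by (simp add: mult.assoc[symmetric])
  then have "s * (a * v) \<in> L \<inter> N"
    using left_submodule_scale[OF L(1) st(1) a(2)] left_submodule_scale[OF N(1) st(2) b(2)] by simp
  moreover have "s * (a * v) \<noteq> 0" using torsion_free st a by blast
  ultimately show "L \<inter> N \<noteq> {0}" by blast
qed

text \<open>
  The cyclic modules generated by a maximal independent family are uniform and their sum is
  essential: an element independent of the family could be added to it.
\<close>

lemma has_udim_exists:
  assumes M: "left_submodule R M"
    and bound: "\<And>m v. left_independent R {..<m::nat} v \<Longrightarrow> v ` {..<m} \<subseteq> M \<Longrightarrow> m \<le> b"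
  shows "\<exists>m. has_udim R M m"
proof -
  define P where "P m \<longleftrightarrow> (\<exists>v. left_independent R {..<m} v \<and> v ` {..<m} \<subseteq> M)" for m :: nat
  have "P 0" by (auto simp: P_def left_independent_def)
  moreover have "m \<le> b" if "P m" for m using that bound by (auto simp: P_def)
  ultimately obtain m where m: "P m" "\<And>k. P k \<Longrightarrow> k \<le> m"
    using Nat.ex_has_greatest_nat[of P 0 b] by blast
  obtain v where v: "left_independent R {..<m} v" "v ` {..<m} \<subseteq> M" using m(1) P_def by blast
  define U where "U i = {r * v i |r. r \<in> R}" for i
  define N where "N = lspan R (\<Union>i<m. U i)"
  have "uniform_module R (U i)" if "i < m" for i
    unfolding U_def using left_independent_nonzero[OF v(1)] that
    by (intro uniform_module_multiples) auto
  moreover have "is_direct_sum R m U N"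
    unfolding is_direct_sum_def
  proof (intro conjI allI impI; (elim conjE)?)
    show "left_submodule R (U i)" for i unfolding U_def by (rule left_submodule_multiples)
    show "N = lspan R (\<Union>i<m. U i)" by (rule N_def)
  next
    fix u i assume u: "\<forall>i<m. u i \<in> U i" "(\<Sum>i<m. u i) = 0" and i: "i < m"
    have "\<forall>i<m. \<exists>c\<in>R. u i = c * v i" using u(1) by (auto simp: U_def)
    then obtain c where c: "\<And>i. i < m \<Longrightarrow> c i \<in> R" "\<And>i. i < m \<Longrightarrow> u i = c i * v i" by metis
    have "(\<Sum>i<m. c i * v i) = 0" using u(2) c(2) by simp
    then have "c i = 0" using left_independentD[OF v(1), of "{..<m}" c i] c(1) i by simp
    then show "u i = 0" using c(2) i by simp
  qed
  moreover have "essential_in R N M"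
    unfolding essential_in_def
  proof (intro conjI allI impI; (elim conjE)?)
    show "left_submodule R N" unfolding N_def by (rule left_submodule_lspan)
    have "U i \<subseteq> M" if "i < m" for i
      unfolding U_def using that v(2) left_submodule_scale[OF M] by blast
    then show "N \<subseteq> M" unfolding N_def by (intro lspan_least M) blast
    fix L assume L: "left_submodule R L" "L \<subseteq> M" "L \<noteq> {0}"
    then obtain y where y: "y \<in> L" "y \<noteq> 0" using left_submodule_zero by blast
    define w where "w = v(m := y)"
    have "w ` {..<Suc m} \<subseteq> M" using v(2) y(1) L(2) by (auto simp: w_def less_Suc_eq)
    \<comment> \<open>By maximality, the extended family satisfies a nontrivial relation.\<close>
    moreover have "\<not> P (Suc m)" using m(2) Suc_n_not_le_n by blast
    ultimately have "\<not> left_independent R {..<Suc m} w" unfolding P_def by blast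
    then obtain c j where c: "\<And>i. i < Suc m \<Longrightarrow> c i \<in> R" "(\<Sum>i<Suc m. c i * w i) = 0"
      "j < Suc m" "c j \<noteq> 0"
      unfolding left_independent_finite[OF finite_lessThan] by (auto simp del: sum.lessThan_Suc)
    have eq: "(\<Sum>i<m. c i * v i) + c m * y = 0" using c(2) by (simp add: w_def)
    have "c m \<noteq> 0"
    proof
      assume "c m = 0"
      then have "(\<Sum>i<m. c i * v i) = 0" using eq by simp
      then have "c i = 0" if "i < m" for i
        using left_independentD[OF v(1), of "{..<m}" c i] c(1) that by simp
      then show False using c(3,4) \<open>c m = 0\<close> by (auto simp: less_Suc_eq)
    qed
    have "c i * v i \<in> N" if "i < m" for i
      unfolding N_def using c(1)[of i] that by (intro lspan_base) (auto simp: U_def)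
    then have "(\<Sum>i<m. c i * v i) \<in> N"
      by (intro left_submodule_sum[of R]) (auto simp: N_def left_submodule_lspan)
    then have "- (\<Sum>i<m. c i * v i) \<in> N"
      by (intro left_submodule_uminus) (auto simp: N_def left_submodule_lspan)
    then have "c m * y \<in> N" by (simp add: minus_unique[OF eq])
    moreover have "c m * y \<in> L" using left_submodule_scale[OF L(1) c(1) y(1)] by simp
    moreover have "c m * y \<noteq> 0" using torsion_free c(1)[of m] \<open>c m \<noteq> 0\<close> y(2) by blast
    ultimately show "L \<inter> N \<noteq> {0}" by blast
  qed
  ultimately show ?thesis unfolding has_udim_def by blast
qed

lemma udim_finite:
  assumes "left_submodule R M" "finite E" "M \<subseteq> lspan R (e ` E)"
  obtains m where "udim R M = enat m" "m \<le> card E"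
    "\<And>(I :: 'j set) w. finite I \<Longrightarrow> left_independent R I w \<Longrightarrow> w ` I \<subseteq> M \<Longrightarrow> card I \<le> m"
proof -
  have le: "m \<le> card E" if "left_independent R {..<m::nat} v" "v ` {..<m} \<subseteq> M" for m v
    using independent_card_le_spanning[OF assms(2) finite_lessThan that(1), of e] that(2) assms(3)
    by fastforce
  then obtain m where m: "has_udim R M m" using has_udim_exists[OF assms(1)] by blast
  have "(THE k. has_udim R M k) = m"
  proof (rule the_equality)
    show "has_udim R M m" by (rule m)
    show "k = m" if "has_udim R M k" for k by (rule has_udim_unique[OF that m assms(1)])
  qed
  then have "udim R M = enat m" using m by (auto simp: udim_def)
  moreover have "m \<le> card E"
    using has_udim_independent[OF m assms(1)] le by metis
  moreover have "card I \<le> m" if "finite I" "left_independent R I w" "w ` I \<subseteq> M" for I :: "'j set" and w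
    by (rule has_udim_bounds_independent[OF m assms(1) that])
  ultimately show ?thesis by (rule that)
qed

end

section \<open>Words and ordered monomials\<close>

locale skew_PBW =
  fixes R :: "'a::ring_1 set" and n :: nat and x :: "nat \<Rightarrow> 'a"
  assumes PBW: "skew_PBW_extension R n x"

sublocale skew_PBW \<subseteq> scalar_subring
  using PBW by unfold_locales (simp add: skew_PBW_extension_def)

lemma prod_list_map_replicate: "prod_list (map x (replicate k i)) = x i ^ k"
  by (induction k) auto

lemma prod_list_map_concat_replicate:
  "prod_list (map x (concat (map (\<lambda>i. replicate (\<alpha> i) i) xs))) = prod_list (map (\<lambda>i. x i ^ \<alpha> i) xs)"
  by (induction xs) (simp_all add: prod_list_map_replicate del: map_replicate)

lemma sorted_concat_replicate:
  "sorted xs \<Longrightarrow> sorted (concat (map (\<lambda>i. replicate (\<alpha> i) i) xs))"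
  by (induction xs) (auto simp: sorted_append sorted_replicate)

lemma count_list_concat_replicate:
  "distinct xs \<Longrightarrow>
    count_list (concat (map (\<lambda>i. replicate (\<alpha> i) i) xs)) j = (if j \<in> set xs then \<alpha> j else 0)"
proof (induction xs)
  case (Cons i xs)
  have "count_list (replicate k i) j = (if i = j then k else 0)" for k by (induction k) auto
  with Cons show ?case by auto
qed simp

lemma sort_eq_concat_replicate:
  fixes w :: "'b::linorder list"
  assumes "set w \<subseteq> set xs" "sorted xs" "distinct xs"
  shows "sort w = concat (map (\<lambda>i. replicate (count_list w i) i) xs)"
proof (rule properties_for_sort[rotated])
  show "sorted (concat (map (\<lambda>i. replicate (count_list w i) i) xs))"
    by (rule sorted_concat_replicate[OF assms(2)])
  have "count_list w j = 0" if "j \<notin> set xs" for j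
    using that assms(1) by (auto simp: count_list_0_iff)
  then show "mset (concat (map (\<lambda>i. replicate (count_list w i) i) xs)) = mset w"
    by (auto intro!: multiset_eqI simp: count_mset count_list_concat_replicate[OF assms(3)])
qed

context skew_PBW
begin

definition word :: "nat list \<Rightarrow> 'a" where
  "word w = prod_list (map x w)"

definition words :: "nat \<Rightarrow> nat list set" where
  "words k = {w. set w \<subseteq> {1..n} \<and> length w < k}"

text \<open>
  The strict length bound lets the remainder terms of a rewriting step be named uniformly, also
  for the empty word.
\<close>

definition wspan :: "nat \<Rightarrow> 'a set" where
  "wspan k = lspan R (word ` words k)"

lemma word_simps [simp]: "word [] = 1" "word (i # w) = x i * word w"
  "word (v @ w) = word v * word w"
  by (simp_all add: word_def)

lemma left_submodule_wspan: "left_submodule R (wspan k)"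
  unfolding wspan_def by (rule left_submodule_lspan)

lemmas wspan_add = left_submodule_add[OF left_submodule_wspan]
  and wspan_scale = left_submodule_scale[OF left_submodule_wspan]

lemma wspan_mono: "k \<le> l \<Longrightarrow> wspan k \<subseteq> wspan l"
  unfolding wspan_def by (intro lspan_mono image_mono) (auto simp: words_def)

lemma word_in_wspan: "set w \<subseteq> {1..n} \<Longrightarrow> length w < k \<Longrightarrow> word w \<in> wspan k"
  unfolding wspan_def by (rule lspan_base) (auto simp: words_def)

lemma wspan_induct [consumes 1, case_names zero add word]:
  assumes "y \<in> wspan k" "P 0" "\<And>u v. P u \<Longrightarrow> P v \<Longrightarrow> P (u + v)"
    and "\<And>r w. r \<in> R \<Longrightarrow> set w \<subseteq> {1..n} \<Longrightarrow> length w < k \<Longrightarrow> P (r * word w)"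
  shows "P y"
proof -
  obtain J c where J: "finite J" "J \<subseteq> words k" "\<forall>j\<in>J. c j \<in> R" "y = (\<Sum>j\<in>J. c j * word j)"
    using assms(1) unfolding wspan_def lspan_family_iff by blast
  have "P (\<Sum>j\<in>J. c j * word j)"
    using J(1-3) by (induction J rule: finite_induct) (auto simp: words_def intro!: assms(2-4))
  then show ?thesis using J(4) by simp
qed

lemma variable_scalar_commute:
  assumes "i \<in> {1..n}" "r \<in> R"
  obtains c d where "c \<in> R" "d \<in> R" "x i * r = c * x i + d"
proof (cases "r = 0")
  case True
  then show ?thesis using that[of 0 0] R_zero by simp
next
  case False
  then obtain c where "c \<in> R" "x i * r - c * x i \<in> R"
    using PBW assms unfolding skew_PBW_extension_def by (metis DiffD1 DiffI singletonD)
  then show ?thesis using that[of c "x i * r - c * x i"] by simp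
qed

lemma variables_commute:
  assumes "i \<in> {1..n}" "j \<in> {1..n}"
  obtains c l where "c \<in> R" "l \<in> wspan 2" "x j * x i = c * (x i * x j) + l"
proof -
  obtain c where c: "c \<in> R" "x j * x i - c * x i * x j \<in> lspan R (insert 1 (x ` {1..n}))"
    using PBW assms unfolding skew_PBW_extension_def by (metis DiffD1)
  have "1 \<in> wspan 2" using word_in_wspan[of "[]" 2] by simp
  moreover have "x i \<in> wspan 2" if "i \<in> {1..n}" for i using word_in_wspan[of "[i]" 2] that by simp
  ultimately have "lspan R (insert 1 (x ` {1..n})) \<subseteq> wspan 2"
    by (intro lspan_least left_submodule_wspan) blast
  then show ?thesis using that[of c "x j * x i - c * x i * x j"] c by (auto simp: mult.assoc)
qed

lemma variable_times_wspan:
  assumes i: "i \<in> {1..n}" and "y \<in> wspan k"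
  shows "x i * y \<in> wspan (Suc k)"
  using assms(2)
proof (induction rule: wspan_induct)
  case zero
  then show ?case using left_submodule_zero[OF left_submodule_wspan] by simp
next
  case (add u v)
  then show ?case by (simp add: distrib_left wspan_add)
next
  case (word r w)
  obtain c d where cd: "c \<in> R" "d \<in> R" "x i * r = c * x i + d"
    using variable_scalar_commute[OF i word(1)] .
  have "x i * (r * word w) = c * word (i # w) + d * word w"
    by (simp add: mult.assoc[symmetric] cd(3) distrib_right)
  also have "\<dots> \<in> wspan (Suc k)"
    using cd word i by (intro wspan_add wspan_scale word_in_wspan) auto
  finally show ?case .
qed

lemma word_times_wspan:
  assumes "set v \<subseteq> {1..n}" "y \<in> wspan k"
  shows "word v * y \<in> wspan (length v + k)"
  using assms(1)
  by (induction v) (use assms(2) variable_times_wspan in \<open>auto simp: mult.assoc\<close>)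

text \<open>
  The filtration is multiplicative. The strict length bounds account for the shift: words shorter than
  \<open>k + 1\<close> and \<open>l\<close> have a product shorter than \<open>k + l\<close>.
\<close>

lemma wspan_mult:
  assumes "y \<in> wspan (Suc k)" "z \<in> wspan l"
  shows "y * z \<in> wspan (k + l)"
  using assms(1)
proof (induction rule: wspan_induct)
  case zero
  then show ?case using left_submodule_zero[OF left_submodule_wspan] by simp
next
  case (add u v)
  then show ?case by (simp add: distrib_right wspan_add)
next
  case (word r w)
  then have "word w * z \<in> wspan (k + l)"
    using word_times_wspan[OF word(2) assms(2)] wspan_mono[of "length w + l" "k + l"] by auto
  then show ?case using word(1) by (simp add: mult.assoc wspan_scale)
qed

lemma prod_list_in_wspan:
  "set vs \<subseteq> wspan (Suc d) \<Longrightarrow> prod_list vs \<in> wspan (Suc (d * length vs))"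
proof (induction vs)
  case Nil
  then show ?case using word_in_wspan[of "[]" 1] by simp
next
  case (Cons v vs)
  then show ?case using wspan_mult[of v d "prod_list vs" "Suc (d * length vs)"] by simp
qed

text \<open>
  A congruence between \<open>u\<close> and a multiple of a word, modulo shorter words, survives multiplication
  by a variable from the left. The scalar may change, but only its membership in \<open>R\<close> matters
  for sorting.
\<close>

lemma variable_times_word_multiple:
  assumes i: "i \<in> {1..n}" and v: "set v \<subseteq> {1..n}" and "r \<in> R" and "u - r * word v \<in> wspan (length v)"
  shows "\<exists>c\<in>R. x i * u - c * word (i # v) \<in> wspan (Suc (length v))"
proof -
  obtain c d where cd: "c \<in> R" "d \<in> R" "x i * r = c * x i + d"
    using variable_scalar_commute[OF i \<open>r \<in> R\<close>] .
  have "x i * u - c * word (i # v) = x i * (u - r * word v) + d * word v"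
    by (simp add: right_diff_distrib mult.assoc[symmetric] cd(3) distrib_right)
  moreover have "x i * (u - r * word v) + d * word v \<in> wspan (Suc (length v))"
    using cd v by (intro wspan_add wspan_scale word_in_wspan variable_times_wspan[OF i assms(4)]) auto
  ultimately have "x i * u - c * word (i # v) \<in> wspan (Suc (length v))" by simp
  then show ?thesis using cd(1) by blast
qed

text \<open>
  One step of insertion sort: a letter moves to the right past each smaller one, and every exchange
  of neighbours costs a scalar and a combination of words that are shorter by at least one.
\<close>

lemma word_insort:
  assumes "i \<in> {1..n}" "set v \<subseteq> {1..n}"
  shows "\<exists>r\<in>R. word (i # v) - r * word (insort i v) \<in> wspan (length (i # v))"
  using assms(2)
proof (induction v)
  case Nil
  then show ?case
    using R_one left_submodule_zero[OF left_submodule_wspan] by (intro bexI[of _ 1]) auto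
next
  case (Cons j s)
  show ?case
  proof (cases "i \<le> j")
    case True
    then show ?thesis
      using R_one left_submodule_zero[OF left_submodule_wspan] by (intro bexI[of _ 1]) auto
  next
    case False
    have s: "set s \<subseteq> {1..n}" and j: "j \<in> {1..n}" using Cons.prems by auto
    obtain c l where cl: "c \<in> R" "l \<in> wspan 2" "x i * x j = c * (x j * x i) + l"
      using variables_commute[OF j assms(1)] .
    obtain r where r: "r \<in> R" "word (i # s) - r * word (insort i s) \<in> wspan (length (insort i s))"
      using Cons.IH[OF s] by auto
    then obtain d where d: "d \<in> R"
      "x j * word (i # s) - d * word (j # insort i s) \<in> wspan (Suc (length (insort i s)))"
      using variable_times_word_multiple[OF j _ r] s assms(1) by (auto simp: set_insort_key)
    have "l * word s \<in> wspan (1 + Suc (length s))"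
      using cl(2) s by (intro wspan_mult word_in_wspan) (auto simp: numeral_2_eq_2)
    moreover have "word (i # j # s) - (c * d) * word (insort i (j # s)) =
        c * (x j * word (i # s) - d * word (j # insort i s)) + l * word s"
      using False
      by (simp add: right_diff_distrib mult.assoc[symmetric] cl(3) distrib_right)
    ultimately have "word (i # j # s) - (c * d) * word (insort i (j # s)) \<in> wspan (length (i # j # s))"
      using d(2) cl(1) by (auto intro!: wspan_add wspan_scale)
    then show ?thesis using R_mult[OF cl(1) d(1)] by blast
  qed
qed

lemma word_sort:
  assumes "set w \<subseteq> {1..n}"
  shows "\<exists>r\<in>R. word w - r * word (sort w) \<in> wspan (length w)"
  using assms
proof (induction w)
  case Nil
  then show ?case
    using R_one left_submodule_zero[OF left_submodule_wspan] by (intro bexI[of _ 1]) auto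
next
  case (Cons i w)
  have w: "set w \<subseteq> {1..n}" and i: "i \<in> {1..n}" using Cons.prems by auto
  obtain r where r: "r \<in> R" "word w - r * word (sort w) \<in> wspan (length (sort w))"
    using Cons.IH[OF w] by auto
  then obtain c where c: "c \<in> R" "word (i # w) - c * word (i # sort w) \<in> wspan (Suc (length w))"
    using variable_times_word_multiple[OF i _ r] w by auto
  obtain s where s: "s \<in> R" "word (i # sort w) - s * word (insort i (sort w)) \<in> wspan (Suc (length w))"
    using word_insort[OF i, of "sort w"] w by auto
  have "word (i # w) - (c * s) * word (sort (i # w)) =
      (word (i # w) - c * word (i # sort w)) + c * (word (i # sort w) - s * word (insort i (sort w)))"
    by (simp add: right_diff_distrib mult.assoc)
  also have "\<dots> \<in> wspan (Suc (length w))"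
    using c s by (intro wspan_add wspan_scale)
  finally show ?case using R_mult[OF c(1) s(1)] by auto
qed

definition bounded_exponents :: "nat \<Rightarrow> (nat \<Rightarrow> nat) set" where
  "bounded_exponents k = {\<alpha> \<in> exponents n. (\<Sum>i=1..n. \<alpha> i) \<le> k}"

lemma word_sort_eq_pbw_monom:
  assumes "set w \<subseteq> {1..n}"
  shows "word (sort w) = pbw_monom n x (count_list w)"
proof -
  have "sort w = concat (map (\<lambda>i. replicate (count_list w i) i) [1..<Suc n])"
    using assms by (intro sort_eq_concat_replicate) (auto simp del: upt_Suc)
  then show ?thesis by (simp add: word_def pbw_monom_def prod_list_map_concat_replicate)
qed

lemma count_list_in_exponents: "set w \<subseteq> {1..n} \<Longrightarrow> count_list w \<in> exponents n"
  by (auto simp: exponents_def count_list_0_iff)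

lemma sum_count_list: "set w \<subseteq> {1..n} \<Longrightarrow> (\<Sum>i=1..n. count_list w i) = length w"
  by (rule sum_count_set) auto

lemma pbw_monom_eq_word:
  assumes "\<alpha> \<in> exponents n"
  obtains w where "set w \<subseteq> {1..n}" "pbw_monom n x \<alpha> = word w" "length w = (\<Sum>i=1..n. \<alpha> i)"
proof -
  let ?w = "concat (map (\<lambda>i. replicate (\<alpha> i) i) [1..<Suc n])"
  have w: "set ?w \<subseteq> {1..n}" by auto
  have \<alpha>: "count_list ?w j = \<alpha> j" for j
    using assms by (subst count_list_concat_replicate) (auto simp: exponents_def simp del: upt_Suc)
  have "length ?w = (\<Sum>i=1..n. count_list ?w i)" by (rule sum_count_list[OF w, symmetric])
  also have "\<dots> = (\<Sum>i=1..n. \<alpha> i)" by (intro sum.cong refl \<alpha>)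
  finally have "length ?w = (\<Sum>i=1..n. \<alpha> i)" .
  moreover have "pbw_monom n x \<alpha> = word ?w"
    by (simp add: word_def pbw_monom_def prod_list_map_concat_replicate)
  ultimately show ?thesis using that w by blast
qed

text \<open>
  Sorting a word leaves a remainder of shorter words, so induction on the length rewrites every
  word into ordered monomials.
\<close>

lemma wspan_Suc_eq: "wspan (Suc k) = lspan R (pbw_monom n x ` bounded_exponents k)"
proof
  show "lspan R (pbw_monom n x ` bounded_exponents k) \<subseteq> wspan (Suc k)"
  proof (rule lspan_least[OF _ left_submodule_wspan], rule image_subsetI)
    fix \<alpha> assume "\<alpha> \<in> bounded_exponents k"
    then have "\<alpha> \<in> exponents n" "(\<Sum>i=1..n. \<alpha> i) \<le> k" by (auto simp: bounded_exponents_def)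
    then show "pbw_monom n x \<alpha> \<in> wspan (Suc k)"
      using word_in_wspan pbw_monom_eq_word[of \<alpha>] by (metis less_Suc_eq_le)
  qed
next
  let ?F = "\<lambda>k. lspan R (pbw_monom n x ` bounded_exponents k)"
  have "word w \<in> ?F k" if "set w \<subseteq> {1..n}" "length w \<le> k" for w
    using that
  proof (induction "length w" arbitrary: w rule: less_induct)
    case less
    obtain r where r: "r \<in> R" "word w - r * word (sort w) \<in> wspan (length w)"
      using word_sort[OF less.prems(1)] by blast
    have "wspan (length w) \<subseteq> ?F k"
      unfolding wspan_def using less
      by (intro lspan_least left_submodule_lspan) (auto simp: words_def)
    moreover have "count_list w \<in> bounded_exponents k"
      using less.prems count_list_in_exponents sum_count_list by (auto simp: bounded_exponents_def)
    then have "r * word (sort w) \<in> ?F k"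
      using r(1) unfolding word_sort_eq_pbw_monom[OF less.prems(1)]
      by (intro left_submodule_scale[OF left_submodule_lspan] lspan_base) auto
    ultimately have "(word w - r * word (sort w)) + r * word (sort w) \<in> ?F k"
      using r(2) by (intro left_submodule_add[OF left_submodule_lspan]) auto
    then show ?case by simp
  qed
  then show "wspan (Suc k) \<subseteq> ?F k"
    unfolding wspan_def
    by (intro lspan_least left_submodule_lspan) (auto simp: words_def)
qed

lemma left_independent_monomials: "left_independent R (exponents n) (pbw_monom n x)"
  using PBW by (simp add: skew_PBW_extension_def left_basis_def)

lemma in_lspan_monomials: "y \<in> lspan R (pbw_monom n x ` exponents n)"
  using PBW by (simp add: skew_PBW_extension_def left_basis_def)

text \<open>The degrees in the finitely many terms of an element are bounded.\<close>

lemma wspan_exhausts: "\<exists>d. y \<in> wspan (Suc d)"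
proof -
  obtain J c where J: "finite J" "J \<subseteq> exponents n" "\<forall>j\<in>J. c j \<in> R"
    "y = (\<Sum>j\<in>J. c j * pbw_monom n x j)"
    using in_lspan_monomials[of y] unfolding lspan_family_iff by blast
  define d where "d = Max (insert 0 ((\<lambda>\<alpha>. \<Sum>i=1..n. \<alpha> i) ` J))"
  have "J \<subseteq> bounded_exponents d" using J(1,2) by (auto simp: bounded_exponents_def d_def)
  then have "y \<in> wspan (Suc d)"
    unfolding wspan_Suc_eq J(4) using J(3) by (intro lspan_familyI) auto
  then show ?thesis ..
qed

lemma finite_subset_wspan:
  assumes "finite S"
  shows "\<exists>d. S \<subseteq> wspan (Suc d)"
proof -
  obtain f where f: "\<And>y. y \<in> wspan (Suc (f y))" using wspan_exhausts by metis
  have "S \<subseteq> wspan (Suc (Max (insert 0 (f ` S))))"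
  proof
    fix y assume "y \<in> S"
    then have "Suc (f y) \<le> Suc (Max (insert 0 (f ` S)))" using assms by simp
    then show "y \<in> wspan (Suc (Max (insert 0 (f ` S))))" using f wspan_mono by blast
  qed
  then show ?thesis ..
qed

text \<open>A free module over a domain is torsion free, by comparing coefficients.\<close>

lemma torsion_free_over_domain:
  assumes "is_domain R" "r \<in> R" "r * y = 0" "r \<noteq> 0"
  shows "y = 0"
proof -
  obtain J c where J: "finite J" "J \<subseteq> exponents n" "\<forall>j\<in>J. c j \<in> R"
    "y = (\<Sum>j\<in>J. c j * pbw_monom n x j)"
    using in_lspan_monomials[of y] unfolding lspan_family_iff by blast
  have "(\<Sum>j\<in>J. (r * c j) * pbw_monom n x j) = 0"
    using assms(3) unfolding J(4) by (simp add: sum_distrib_left mult.assoc)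
  then have "r * c j = 0" if "j \<in> J" for j
    using left_independentD[OF left_independent_monomials J(1,2), of "\<lambda>j. r * c j"]
      that J(3) assms(2) R_mult by blast
  then have "c j = 0" if "j \<in> J" for j
    using assms(1,2,4) J(3) that unfolding is_domain_def by blast
  then show ?thesis using J(4) by simp
qed

end

section \<open>Counting monomials\<close>

lemma card_exponents_degree:
  "card {\<alpha> \<in> exponents n. (\<Sum>i=1..n. \<alpha> i) = k} = (k + n - 1) choose k"
proof -
  let ?A = "{\<alpha> \<in> exponents n. (\<Sum>i=1..n. \<alpha> i) = k}"
  let ?f = "\<lambda>\<alpha> :: nat \<Rightarrow> nat. map \<alpha> [1..<Suc n]"
  have sum: "sum_list (?f \<alpha>) = (\<Sum>i=1..n. \<alpha> i)" for \<alpha>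
    by (simp add: interv_sum_list_conv_sum_set_nat atLeastLessThanSuc_atLeastAtMost del: upt_Suc)
  have "bij_betw ?f ?A {l. length l = n \<and> sum_list l = k}"
  proof (rule bij_betw_imageI)
    show "inj_on ?f ?A"
    proof (rule inj_onI, rule ext)
      fix \<alpha> \<beta> i assume *: "\<alpha> \<in> ?A" "\<beta> \<in> ?A" "?f \<alpha> = ?f \<beta>"
      show "\<alpha> i = \<beta> i"
      proof (cases "i \<in> {1..n}")
        case True
        then show ?thesis using *(3) by (auto simp del: upt_Suc)
      next
        case False
        then show ?thesis using *(1,2) by (auto simp: exponents_def)
      qed
    qed
    show "?f ` ?A = {l. length l = n \<and> sum_list l = k}"
    proof (intro equalityI subsetI)
      fix l assume "l \<in> ?f ` ?A"
      then show "l \<in> {l. length l = n \<and> sum_list l = k}" using sum by (auto simp del: upt_Suc)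
    next
      fix l :: "nat list" assume l: "l \<in> {l. length l = n \<and> sum_list l = k}"
      define \<alpha> where "\<alpha> i = (if i \<in> {1..n} then l ! (i - 1) else 0)" for i
      have "?f \<alpha> = l" using l by (intro nth_equalityI) (auto simp: \<alpha>_def simp del: upt_Suc)
      moreover have "\<alpha> \<in> ?A"
        using sum[of \<alpha>] l unfolding \<open>?f \<alpha> = l\<close> by (auto simp: exponents_def \<alpha>_def)
      ultimately show "l \<in> ?f ` ?A" by blast
    qed
  qed
  from bij_betw_same_card[OF this] show ?thesis by (simp only: card_length_sum_list)
qed

lemma finite_exponents_degree:
  assumes "n \<ge> 1"
  shows "finite {\<alpha> \<in> exponents n. (\<Sum>i=1..n. \<alpha> i) = k}"
proof (rule card_ge_0_finite)
  show "0 < card {\<alpha> \<in> exponents n. (\<Sum>i=1..n. \<alpha> i) = k}"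
    unfolding card_exponents_degree using assms by (simp add: zero_less_binomial_iff)
qed

lemma sum_choose_degree:
  assumes "n \<ge> 1"
  shows "(\<Sum>i\<le>k. (i + n - 1) choose i) = (n + k) choose n"
proof -
  obtain m where n: "n = Suc m" using assms by (cases n) auto
  have "(\<Sum>i\<le>k. (i + n - 1) choose i) = (\<Sum>i\<le>k. (m + i) choose i)"
    by (simp add: n add.commute)
  also have "\<dots> = (n + k) choose k" by (simp add: sum_choose_lower n)
  finally show ?thesis using binomial_symmetric[of k "n + k"] by simp
qed

lemma card_exponents_bounded:
  assumes "n \<ge> 1"
  shows "finite {\<alpha> \<in> exponents n. (\<Sum>i=1..n. \<alpha> i) \<le> k}"
    and "card {\<alpha> \<in> exponents n. (\<Sum>i=1..n. \<alpha> i) \<le> k} = (n + k) choose n"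
proof -
  let ?D = "\<lambda>j. {\<alpha> \<in> exponents n. (\<Sum>i=1..n. \<alpha> i) = j}"
  have eq: "{\<alpha> \<in> exponents n. (\<Sum>i=1..n. \<alpha> i) \<le> k} = (\<Union>j\<le>k. ?D j)" by auto
  have fin: "finite (?D j)" for j by (rule finite_exponents_degree[OF assms])
  show "finite {\<alpha> \<in> exponents n. (\<Sum>i=1..n. \<alpha> i) \<le> k}" unfolding eq using fin by blast
  have "card (\<Union>j\<le>k. ?D j) = (\<Sum>j\<le>k. card (?D j))"
    using fin by (intro card_UN_disjoint) auto
  then show "card {\<alpha> \<in> exponents n. (\<Sum>i=1..n. \<alpha> i) \<le> k} = (n + k) choose n"
    unfolding eq card_exponents_degree sum_choose_degree[OF assms] .
qed

lemma log_const_tendsto_0: "(\<lambda>k. log (real k) c) \<longlonglongrightarrow> 0"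
  unfolding log_def
  by (intro tendsto_divide_0[OF tendsto_const] filterlim_at_top_imp_at_infinity
      filterlim_compose[OF ln_at_top filterlim_real_sequentially])

text \<open>
  For \<open>k \<ge> 1\<close> the binomial coefficient lies between \<open>(k/n)\<^sup>n\<close> and \<open>((n + d) k)\<^sup>n\<close>, and constant factors
  disappear in the limit of the logarithms to base \<open>k\<close>.
\<close>

lemma log_choose_tendsto:
  fixes n d :: nat
  assumes "n \<ge> 1" "d \<ge> 1"
  shows "(\<lambda>k. log (real k) (real ((n + d * k) choose n))) \<longlonglongrightarrow> real n"
proof (rule tendsto_sandwich)
  show "(\<lambda>k. real n * (1 - log (real k) (real n))) \<longlonglongrightarrow> real n"
    using tendsto_mult[OF tendsto_const[of "real n"] tendsto_diff[OF tendsto_const[of 1] log_const_tendsto_0[of "real n"]]]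
    by simp
  show "(\<lambda>k. real n * (log (real k) (real (n + d)) + 1)) \<longlonglongrightarrow> real n"
    using tendsto_mult[OF tendsto_const[of "real n"] tendsto_add[OF log_const_tendsto_0[of "real (n + d)"] tendsto_const[of 1]]]
    by simp
  show "\<forall>\<^sub>F k in sequentially.
      real n * (1 - log (real k) (real n)) \<le> log (real k) (real ((n + d * k) choose n))"
    using eventually_ge_at_top[of 2]
  proof eventually_elim
    case (elim k)
    have "1 * k \<le> d * k" using assms(2) by (rule mult_right_mono) simp
    then have "real k \<le> real (n + d * k)" by (simp only: of_nat_le_iff)
    then have "(real k / real n) ^ n \<le> (real (n + d * k) / real n) ^ n"
      by (intro power_mono divide_right_mono) auto
    also have "\<dots> \<le> real ((n + d * k) choose n)" by (rule binomial_ge_n_over_k_pow_k) simp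
    finally have "log (real k) ((real k / real n) ^ n) \<le> log (real k) (real ((n + d * k) choose n))"
      using elim assms by (subst log_le_cancel_iff) (auto simp: zero_less_binomial_iff)
    moreover have "log (real k) ((real k / real n) ^ n) = real n * (1 - log (real k) (real n))"
      using elim assms by (simp add: log_nat_power log_divide)
    ultimately show ?case by simp
  qed
  show "\<forall>\<^sub>F k in sequentially.
      log (real k) (real ((n + d * k) choose n)) \<le> real n * (log (real k) (real (n + d)) + 1)"
    using eventually_ge_at_top[of 2]
  proof eventually_elim
    case (elim k)
    have "(n + d * k) choose n \<le> (n + d * k) ^ n" by (rule binomial_le_pow) simp
    also have "n + d * k \<le> (n + d) * k" using elim by (simp add: distrib_right)
    then have "(n + d * k) ^ n \<le> ((n + d) * k) ^ n" by (rule power_mono) simp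
    finally have "real ((n + d * k) choose n) \<le> (real (n + d) * real k) ^ n"
      by (metis of_nat_le_iff of_nat_mult of_nat_power)
    then have "log (real k) (real ((n + d * k) choose n)) \<le> log (real k) ((real (n + d) * real k) ^ n)"
      using elim assms by (subst log_le_cancel_iff) (auto simp: zero_less_binomial_iff)
    also have "\<dots> = real n * (log (real k) (real (n + d)) + 1)"
      using elim assms by (simp add: log_nat_power log_mult del: of_nat_add)
    finally show ?case .
  qed
qed

lemma limsup_log_choose:
  fixes n d :: nat
  assumes "n \<ge> 1" "d \<ge> 1"
  shows "limsup (\<lambda>k. ereal (log (real k) (real ((n + d * k) choose n)))) = ereal (real n)"
  by (rule lim_imp_Limsup) (auto intro: log_choose_tendsto[OF assms])

lemma poly_eq_of_eventually_eq:
  fixes p q :: "'b::{idom, ring_char_0} poly"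
  assumes "\<forall>\<^sub>F k in sequentially. poly p (of_nat k) = poly q (of_nat k)"
  shows "p = q"
proof (rule ccontr)
  assume "p \<noteq> q"
  then have "finite {z. poly (p - q) z = 0}" by (intro poly_roots_finite) simp
  moreover obtain N where N: "\<And>k. k \<ge> N \<Longrightarrow> poly p (of_nat k) = poly q (of_nat k)"
    using assms by (auto simp: eventually_sequentially)
  then have "of_nat ` {N..} \<subseteq> {z. poly (p - q) z = 0}" by auto
  ultimately have "finite (of_nat ` {N..} :: 'b set)" by (rule rev_finite_subset)
  then have "finite {N..}" by (rule finite_imageD) (simp add: inj_on_def)
  then show False using infinite_Ici by blast
qed

text \<open>The polynomial is \<open>(t + 1) \<cdots> (t + m) / m!\<close>.\<close>

lemma choose_as_poly:
  obtains p :: "rat poly" where "degree p = m" "\<And>k. poly p (of_nat k) = of_nat ((k + m) choose k)"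
proof
  let ?q = "\<Prod>i\<in>{0..<m}. [:1 + of_nat i, 1:] :: rat poly"
  let ?p = "smult (1 / fact m) ?q"
  have "degree ?q = (\<Sum>i\<in>{0..<m}. degree [:1 + of_nat i, 1 :: rat:])"
    by (rule degree_prod_eq_sum_degree) simp
  then show "degree ?p = m" by simp
  fix k
  have "of_nat ((k + m) choose k) = (of_nat ((k + m) choose m) :: rat)"
    using binomial_symmetric[of k "k + m"] by simp
  also have "\<dots> = pochhammer (of_nat (k + m) - of_nat m + 1) m / fact m"
    by (simp add: binomial_gbinomial gbinomial_pochhammer')
  also have "\<dots> = poly ?p (of_nat k)"
    by (simp add: pochhammer_prod poly_prod add_ac)
  finally show "poly ?p (of_nat k) = of_nat ((k + m) choose k)" ..
qed


section \<open>Growth of frames\<close>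

lemma elog_le_log:
  assumes "k \<ge> 2" "l \<le> m" "m > 0"
  shows "elog k (enat l) \<le> ereal (log (real k) (real m))"
  using assms by (auto simp: elog_def)

locale skew_PBW_noetherian_domain = skew_PBW +
  assumes noetherian: "left_noetherian R" and domain: "is_domain R" and n_pos: "n \<ge> 1"

sublocale skew_PBW_noetherian_domain \<subseteq> ore_torsion_free
proof
  show "\<exists>s\<in>R. \<exists>t\<in>R. s \<noteq> 0 \<and> s * a = t * b" if "a \<in> R" "b \<in> R" "b \<noteq> 0" for a b
    using left_noetherian_domain_ore[OF subring noetherian domain that] .
  show "r = 0 \<or> y = 0" if "r \<in> R" "r * y = 0" for r y
    using torsion_free_over_domain[OF domain that] by blast
qed

context skew_PBW_noetherian_domain
begin

lemma finite_bounded_exponents: "finite (bounded_exponents k)"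
  and card_bounded_exponents: "card (bounded_exponents k) = (n + k) choose n"
  unfolding bounded_exponents_def by (rule card_exponents_bounded[OF n_pos])+

lemma ldim_semigrad: "ldim R (semigrad R n x k) = (k + n - 1) choose k"
proof -
  let ?A = "{\<alpha> \<in> exponents n. (\<Sum>i=1..n. \<alpha> i) = k}"
  have "semigrad R n x k = lspan R (pbw_monom n x ` ?A)"
    unfolding semigrad_def by (rule arg_cong[where f = "lspan R"]) blast
  moreover have "left_independent R ?A (pbw_monom n x)"
    by (rule left_independent_subset[OF left_independent_monomials]) blast
  ultimately have "left_basis R ?A (pbw_monom n x) (semigrad R n x k)"
    by (simp add: left_basis_def)
  then have "ldim R (semigrad R n x k) = card ?A"
    by (rule ldim_eq_card_basis[OF finite_exponents_degree[OF n_pos]])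
  then show ?thesis unfolding card_exponents_degree .
qed

lemma degree_gen_hilbert_poly: "degree (gen_hilbert_poly R n x) = n - 1"
proof -
  obtain p :: "rat poly" where p: "degree p = n - 1"
    "\<And>k. poly p (of_nat k) = of_nat ((k + (n - 1)) choose k)"
    using choose_as_poly[of "n - 1"] by blast
  have eq: "of_nat (ldim R (semigrad R n x k)) = poly p (of_nat k)" for k
    using p(2)[of k] n_pos by (simp add: ldim_semigrad)
  have "gen_hilbert_poly R n x = p"
    unfolding gen_hilbert_poly_def eq
  proof (rule the_equality)
    show "\<forall>\<^sub>F k in sequentially. poly p (of_nat k) = poly p (of_nat k)" by simp
    show "q = p" if "\<forall>\<^sub>F k in sequentially. poly p (of_nat k) = poly q (of_nat k)" for q
      using poly_eq_of_eventually_eq[OF that] by simp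
  qed
  then show ?thesis using p(1) by simp
qed

lemma limsup_log_sum_ldim:
  "limsup (\<lambda>k. ereal (log (real k) (real (\<Sum>i=0..k. ldim R (semigrad R n x i))))) = ereal (real n)"
proof -
  have "(\<Sum>i=0..k. ldim R (semigrad R n x i)) = (n + 1 * k) choose n" for k
    unfolding ldim_semigrad atLeast0AtMost sum_choose_degree[OF n_pos] by simp
  then show ?thesis using limsup_log_choose[OF n_pos, of 1] by simp
qed

lemma frame_power_subset_wspan:
  assumes "V \<subseteq> wspan (Suc d)"
  shows "frame_power R V k \<subseteq> wspan (Suc (d * k))"
  unfolding frame_power_def
proof (rule lspan_least[OF _ left_submodule_wspan], rule subsetI)
  fix y assume "y \<in> {prod_list vs |vs. length vs = k \<and> set vs \<subseteq> V}"
  then obtain vs where "y = prod_list vs" "length vs = k" "set vs \<subseteq> V" by blast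
  then show "y \<in> wspan (Suc (d * k))" using prod_list_in_wspan[of vs d] assms by auto
qed

text \<open>
  A generating set of \<open>V\<close> lies in one step of the filtration, which bounds all powers of \<open>V\<close>. The step
  is enlarged by one to have \<open>d \<ge> 1\<close> in the asymptotics.
\<close>

lemma limsup_frame_le:
  assumes "frame R V"
  shows "limsup (\<lambda>k. elog k (udim R (frame_power R V k))) \<le> ereal (real n)"
proof -
  obtain m b where "left_basis R {..<m::nat} b V"
    using assms unfolding frame_def free_of_rank_def by blast
  then have V: "V = lspan R (b ` {..<m})" by (simp add: left_basis_def)
  obtain d where "b ` {..<m} \<subseteq> wspan (Suc d)"
    using finite_subset_wspan[of "b ` {..<m}"] by auto
  then have "b ` {..<m} \<subseteq> wspan (Suc (Suc d))" using wspan_mono[of "Suc d" "Suc (Suc d)"] by simp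
  then have VW: "V \<subseteq> wspan (Suc (Suc d))"
    unfolding V by (rule lspan_least[OF _ left_submodule_wspan])
  have "elog k (udim R (frame_power R V k)) \<le> ereal (log (real k) (real ((n + Suc d * k) choose n)))"
    if "k \<ge> 2" for k
  proof -
    have "left_submodule R (frame_power R V k)"
      unfolding frame_power_def by (rule left_submodule_lspan)
    moreover have "frame_power R V k \<subseteq> lspan R (pbw_monom n x ` bounded_exponents (Suc d * k))"
      using frame_power_subset_wspan[OF VW] unfolding wspan_Suc_eq .
    ultimately obtain l where "udim R (frame_power R V k) = enat l"
      "l \<le> card (bounded_exponents (Suc d * k))"
      using udim_finite[OF _ finite_bounded_exponents] by metis
    then show ?thesis
      using elog_le_log[OF that] by (simp add: card_bounded_exponents zero_less_binomial_iff)
  qed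
  then have "limsup (\<lambda>k. elog k (udim R (frame_power R V k)))
      \<le> limsup (\<lambda>k. ereal (log (real k) (real ((n + Suc d * k) choose n))))"
    by (intro Limsup_mono eventually_mono[OF eventually_ge_at_top[of 2]])
  also have "\<dots> = ereal (real n)" by (rule limsup_log_choose[OF n_pos]) simp
  finally show ?thesis .
qed

lemma frame_wspan: "frame R (wspan (Suc d))"
proof -
  have "left_independent R (bounded_exponents d) (pbw_monom n x)"
    by (rule left_independent_subset[OF left_independent_monomials]) (auto simp: bounded_exponents_def)
  then have "left_basis R (bounded_exponents d) (pbw_monom n x) (wspan (Suc d))"
    by (simp add: left_basis_def wspan_Suc_eq)
  then have "free_of_rank R (wspan (Suc d)) (card (bounded_exponents d))"
    by (rule free_of_rank_card_basis[OF finite_bounded_exponents])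
  moreover have "1 \<in> wspan (Suc d)" using word_in_wspan[of "[]" "Suc d"] by simp
  ultimately show ?thesis unfolding frame_def by blast
qed

text \<open>
  The frame is the span of \<open>1\<close> and the variables; the monomials of degree at most \<open>k\<close> are
  independent elements of its \<open>k\<close>-th power.
\<close>

lemma limsup_frame_ge:
  "ereal (real n) \<le> limsup (\<lambda>k. elog k (udim R (frame_power R (wspan 2) k)))"
proof -
  let ?V = "wspan 2"
  have x: "x i \<in> ?V" if "i \<in> {1..n}" for i using word_in_wspan[of "[i]" 2] that by simp
  have one: "1 \<in> ?V" using word_in_wspan[of "[]" 2] by simp
  have mon: "pbw_monom n x ` bounded_exponents k \<subseteq> frame_power R ?V k" for k
  proof (rule image_subsetI)
    fix \<alpha> assume "\<alpha> \<in> bounded_exponents k"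
    then have "\<alpha> \<in> exponents n" "(\<Sum>i=1..n. \<alpha> i) \<le> k" by (auto simp: bounded_exponents_def)
    then obtain w where w: "set w \<subseteq> {1..n}" "pbw_monom n x \<alpha> = word w" "length w \<le> k"
      using pbw_monom_eq_word by metis
    \<comment> \<open>Shorter words become products of exactly \<open>k\<close> factors by padding with \<open>1 \<in> V\<close>.\<close>
    let ?vs = "map x w @ replicate (k - length w) 1"
    have "prod_list ?vs = word w" by (simp add: word_def)
    moreover have "length ?vs = k" "set ?vs \<subseteq> ?V" using w x one by auto
    then have "prod_list ?vs \<in> frame_power R ?V k"
      unfolding frame_power_def by (intro lspan_base CollectI exI[of _ ?vs]) simp
    ultimately show "pbw_monom n x \<alpha> \<in> frame_power R ?V k" unfolding w(2) by simp
  qed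
  have ind: "left_independent R (bounded_exponents k) (pbw_monom n x)" for k
    by (rule left_independent_subset[OF left_independent_monomials]) (auto simp: bounded_exponents_def)
  have sub: "?V \<subseteq> wspan (Suc 1)" by (simp add: numeral_2_eq_2)
  have "ereal (log (real k) (real ((n + 1 * k) choose n))) \<le> elog k (udim R (frame_power R ?V k))"
    if "k \<ge> 2" for k
  proof -
    have "left_submodule R (frame_power R ?V k)"
      unfolding frame_power_def by (rule left_submodule_lspan)
    moreover have "frame_power R ?V k \<subseteq> lspan R (pbw_monom n x ` bounded_exponents (1 * k))"
      using frame_power_subset_wspan[OF sub] unfolding wspan_Suc_eq .
    ultimately obtain l where l: "udim R (frame_power R ?V k) = enat l"
      "card (bounded_exponents k) \<le> l"
      using udim_finite[OF _ finite_bounded_exponents] finite_bounded_exponents ind mon by metis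
    have "0 < (n + k) choose n" by (simp add: zero_less_binomial_iff)
    then have "0 < l" using l(2) unfolding card_bounded_exponents by linarith
    then show ?thesis using l that by (auto simp: elog_def card_bounded_exponents)
  qed
  then have "limsup (\<lambda>k. ereal (log (real k) (real ((n + 1 * k) choose n))))
      \<le> limsup (\<lambda>k. elog k (udim R (frame_power R ?V k)))"
    by (intro Limsup_mono eventually_mono[OF eventually_ge_at_top[of 2]])
  then show ?thesis unfolding limsup_log_choose[OF n_pos order_refl] .
qed

lemma GGKdim_eq: "GGKdim R = ereal (real n)"
  unfolding GGKdim_def
proof (rule antisym)
  show "(SUP V\<in>{V. frame R V}. limsup (\<lambda>k. elog k (udim R (frame_power R V k)))) \<le> ereal (real n)"
    by (rule SUP_least) (use limsup_frame_le in auto)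
  have "frame R (wspan 2)" using frame_wspan[of 1] by (simp add: numeral_2_eq_2)
  then show "ereal (real n) \<le> (SUP V\<in>{V. frame R V}. limsup (\<lambda>k. elog k (udim R (frame_power R V k))))"
    using limsup_frame_ge by (intro SUP_upper2[of "wspan 2"]) auto
qed

end

theorem theorem4p4:
  fixes R :: "'a::ring_1 set" and n :: nat and x :: "nat \<Rightarrow> 'a"
  assumes "left_noetherian R"
    and "is_domain R"
    and "n \<ge> 1"
    and "skew_PBW_extension R n x"
  shows "GGKdim R = limsup (\<lambda>k. ereal (log (real k) (real (\<Sum>i=0..k. ldim R (semigrad R n x i)))))
    \<and> limsup (\<lambda>k. ereal (log (real k) (real (\<Sum>i=0..k. ldim R (semigrad R n x i)))))
        = ereal (1 + real (degree (gen_hilbert_poly R n x)))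
    \<and> 1 + degree (gen_hilbert_poly R n x) = n"
proof -
  interpret skew_PBW_noetherian_domain R n x
    using assms by unfold_locales
  have deg: "1 + degree (gen_hilbert_poly R n x) = n"
    using degree_gen_hilbert_poly n_pos by simp
  then have "1 + real (degree (gen_hilbert_poly R n x)) = real n" by linarith
  then show ?thesis using GGKdim_eq limsup_log_sum_ldim deg by simp
qed

end
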